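(* Let $p$ be a prime and let $D\in\mathbb{Z}$ be an integer that is not a perfect square and such that $D$ is a quadratic residue modulo $p$ with $p\nmid D$ if $p$ is odd, and $D\equiv 1 \pmod 8$ if $p=2$. Let $\sqrt{D}\in\mathbb{Q}_p$ denote a square root of $D$ in $\mathbb{Q}_p$. If $D<0$, then the Ruban continued fraction expansion of the $p$-adic number $\sqrt{D}$ is not ultimately periodic.
   Context: $|\cdot|_p$ is the $p$-adic absolute value on $\mathbb{Q}_p$ with $|p|_p=1/p$. The $p$-adic floor function $\lfloor\cdot\rfloor_p:\mathbb{Q}_p\to\mathbb{Q}$ is defined, for $\alpha=\sum_{n=m}^{\infty}c_np^n$ with $c_n\in\{0,\ldots,p-1\}$, $m\in\mathbb{Z}$, $c_m\ne0$, by $\lfloor\alpha\rfloor_p=\sum_{n=m}^{0}c_np^n$ if $m\le 0$ and $\lfloor\alpha\rfloor_p=0$ if $m>0$ (and $\lfloor 0\rfloor_p=0$). The Ruban continued fraction expansion of $\alpha\in\mathbb{Q}_p$ is $[a_0,a_1,a_2,\ldots]$, where $\alpha_0=\alpha$, $a_n=\lfloor\alpha_n\rfloor_p$, and, as long as $\alpha_n\neq a_n$, $\alpha_{n+1}=1/(\alpha_n-a_n)$; the process stops if $\alpha_n=a_n$ (this never happens when $\alpha$ is irrational). The expansion is ultimately periodic if it is infinite and there exist integers $k\ge0$ and $l\ge1$ such that $a_{n+l}=a_n$ for all $n\ge k$. *)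

theory Defs
  imports
    Complex_Main
    "HOL-Computational_Algebra.Computational_Algebra"
    "HOL-Algebra.QuotRing"
    "HOL-Number_Theory.Number_Theory"
begin

section \<open>The field of p-adic numbers\<close>

definition padic_abs_rat :: "nat \<Rightarrow> rat \<Rightarrow> real" where
  "padic_abs_rat p x =
    (if x = 0 then 0
     else case quotient_of x of (a, b) \<Rightarrow>
       real p powi (int (multiplicity (int p) b) - int (multiplicity (int p) a)))"

definition padic_cauchy :: "nat \<Rightarrow> (nat \<Rightarrow> rat) \<Rightarrow> bool" where
  "padic_cauchy p X \<longleftrightarrow>
    (\<forall>e>0. \<exists>N. \<forall>m\<ge>N. \<forall>n\<ge>N. padic_abs_rat p (X m - X n) < e)"

definition padic_cauchy_ring :: "nat \<Rightarrow> (nat \<Rightarrow> rat) ring" where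
  "padic_cauchy_ring p =
    \<lparr>carrier = {X. padic_cauchy p X},
     mult = (\<lambda>X Y n. X n * Y n), one = (\<lambda>n. 1),
     zero = (\<lambda>n. 0), add = (\<lambda>X Y n. X n + Y n)\<rparr>"

definition padic_null :: "nat \<Rightarrow> (nat \<Rightarrow> rat) set" where
  "padic_null p = {X. (\<lambda>n. padic_abs_rat p (X n)) \<longlonglongrightarrow> 0}"

text \<open>
  \<open>Qp p\<close> is the completion of the rationals with respect to the p-adic absolute value:
  Cauchy sequences modulo null sequences. It is a field when \<open>p\<close> is prime. Its elements are
  cosets, i.e. sets of rational sequences.
\<close>

definition Qp :: "nat \<Rightarrow> (nat \<Rightarrow> rat) set ring" where
  "Qp p = padic_cauchy_ring p Quot padic_null p"

definition Qp_of_rat :: "nat \<Rightarrow> rat \<Rightarrow> (nat \<Rightarrow> rat) set" where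
  "Qp_of_rat p q = padic_null p +>\<^bsub>padic_cauchy_ring p\<^esub> (\<lambda>n. q)"

text \<open>The continuous extension of the absolute value; the limit depends only on the coset.\<close>

definition Qp_abs :: "nat \<Rightarrow> (nat \<Rightarrow> rat) set \<Rightarrow> real" where
  "Qp_abs p \<alpha> = (THE r. \<exists>X\<in>\<alpha>. (\<lambda>n. padic_abs_rat p (X n)) \<longlonglongrightarrow> r)"


section \<open>The p-adic floor function\<close>

definition digit_sum :: "nat \<Rightarrow> int \<Rightarrow> (int \<Rightarrow> nat) \<Rightarrow> int \<Rightarrow> rat" where
  "digit_sum p m c N = (\<Sum>n\<in>{m..N}. of_nat (c n) * of_nat p powi n)"

text \<open>
  \<open>Qp_expansion p \<alpha> m c\<close> says that \<open>\<alpha>\<close> is the sum of the series of \<open>c n * p powi n\<close> over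
  \<open>n \<ge> m\<close>, where the \<open>c n\<close> are p-adic digits and the leading digit \<open>c m\<close> is nonzero. The
  values of \<open>c\<close> below \<open>m\<close> are irrelevant.
\<close>

definition Qp_expansion :: "nat \<Rightarrow> (nat \<Rightarrow> rat) set \<Rightarrow> int \<Rightarrow> (int \<Rightarrow> nat) \<Rightarrow> bool" where
  "Qp_expansion p \<alpha> m c \<longleftrightarrow>
    (\<forall>n\<ge>m. c n \<in> {0..p - 1}) \<and> c m \<noteq> 0 \<and>
    (\<lambda>N. Qp_abs p (\<alpha> \<ominus>\<^bsub>Qp p\<^esub> Qp_of_rat p (digit_sum p m c (int N)))) \<longlonglongrightarrow> 0"

definition Qp_floor :: "nat \<Rightarrow> (nat \<Rightarrow> rat) set \<Rightarrow> rat" where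
  "Qp_floor p \<alpha> =
    (if \<alpha> = \<zero>\<^bsub>Qp p\<^esub> then 0
     else THE q. \<exists>m c. Qp_expansion p \<alpha> m c \<and> q = (if m \<le> 0 then digit_sum p m c 0 else 0))"


section \<open>Ruban continued fractions\<close>

text \<open>The value \<open>None\<close> means that the process has stopped before reaching that index.\<close>

primrec ruban_complete_quotient ::
    "nat \<Rightarrow> (nat \<Rightarrow> rat) set \<Rightarrow> nat \<Rightarrow> (nat \<Rightarrow> rat) set option" where
  "ruban_complete_quotient p \<alpha> 0 = Some \<alpha>"
| "ruban_complete_quotient p \<alpha> (Suc n) =
    (case ruban_complete_quotient p \<alpha> n of
       None \<Rightarrow> None
     | Some \<beta> \<Rightarrow>
         if \<beta> = Qp_of_rat p (Qp_floor p \<beta>) then None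
         else Some (inv\<^bsub>Qp p\<^esub> (\<beta> \<ominus>\<^bsub>Qp p\<^esub> Qp_of_rat p (Qp_floor p \<beta>))))"

definition ruban_partial_quotient :: "nat \<Rightarrow> (nat \<Rightarrow> rat) set \<Rightarrow> nat \<Rightarrow> rat option" where
  "ruban_partial_quotient p \<alpha> n = map_option (Qp_floor p) (ruban_complete_quotient p \<alpha> n)"

definition ruban_ultimately_periodic :: "nat \<Rightarrow> (nat \<Rightarrow> rat) set \<Rightarrow> bool" where
  "ruban_ultimately_periodic p \<alpha> \<longleftrightarrow>
    (\<forall>n. ruban_partial_quotient p \<alpha> n \<noteq> None) \<and>
    (\<exists>k l. l \<ge> 1 \<and>
      (\<forall>n\<ge>k. ruban_partial_quotient p \<alpha> (n + l) = ruban_partial_quotient p \<alpha> n))"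

end

theory Submission
  imports Defs
begin

text \<open>
  Suppose that the expansion of \<open>s\<close>, a \<open>p\<close>-adic square root of \<open>D < 0\<close>, is ultimately periodic
  with period \<open>l\<close>. Two facts combine to a contradiction.

  A periodic complete quotient is a root of a rational quadratic polynomial whose two roots have
  nonpositive product.
  The partial quotients determine the expanded number (\<open>ruban_expansion_unique\<close>), because one step
  of the algorithm expands the distance of two numbers with equal floors by a factor of at least
  \<open>p\<close>, while this distance is at most \<open>1\<close>. So some complete quotient \<open>\<beta>\<close> recurs after \<open>l\<close> steps.
  As the partial quotients after the first are positive rationals, undoing \<open>l\<close> steps is a linear
  fractional map with nonnegative coefficients and \<open>C > 0\<close> (\<open>ruban_moebius\<close>). Therefore \<open>\<beta>\<close> is a
  root of \<open>C X\<^sup>2 + (E - A) X - B\<close> with \<open>B \<ge> 0\<close>.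

  On the other hand every complete quotient of \<open>s\<close> has the form \<open>x + y s\<close> with rational \<open>x\<close> and
  \<open>y \<noteq> 0\<close> (\<open>ruban_expansion_lin\<close>). The two conjugate roots have product \<open>- B / C \<le> 0\<close>, but also
  \<open>x\<^sup>2 - D y\<^sup>2 > 0\<close> (\<open>no_positive_fixed_point\<close>).

  Most of the text supplies the arithmetic of the completion that this argument uses: it is a
  field with a multiplicative ultrametric absolute value, digit expansions exist, and the floor is
  the only element of \<open>\<int>[1/p]\<close> in \<open>[0, p)\<close> at distance less than \<open>1\<close> (\<open>is_floor_Qp_floor\<close>,
  \<open>is_floor_unique\<close>).
\<close>

lemma (in abelian_group) minus_minus_cancel:
  assumes "a \<in> carrier G" "b \<in> carrier G" "c \<in> carrier G"
  shows "(a \<ominus> b) \<ominus> (a \<ominus> c) = c \<ominus> b"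
    and "(a \<ominus> b) \<ominus> (c \<ominus> b) = a \<ominus> c"
  using assms by (simp_all add: a_minus_def minus_add a_ac r_neg1 r_neg2)

section \<open>The p-adic absolute value on the rationals\<close>

text \<open>All results up to the last theorem are for a fixed prime \<open>p\<close>.\<close>

locale padic_prime =
  fixes p :: nat
  assumes prime_p: "prime p"
begin

text \<open>\<open>nrm\<close> is the \<open>p\<close>-adic absolute value of rationals.\<close>

abbreviation nrm :: "rat \<Rightarrow> real" where "nrm \<equiv> padic_abs_rat p"

lemma p_gt_1: "p > 1" using prime_p by (rule prime_gt_1_nat)

lemma real_p_gt_1: "real p > 1" using p_gt_1 by simp

lemma real_p_nonzero: "real p \<noteq> 0" using p_gt_1 by simp

lemma prime_elem_int_p: "prime_elem (int p)"
  using prime_p by simp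

lemma nrm_0 [simp]: "nrm 0 = 0"
  by (simp add: padic_abs_rat_def)

lemma nrm_fraction:
  assumes "a \<noteq> 0" "b \<noteq> 0"
  shows "nrm (of_int a / of_int b) =
    real p powi (int (multiplicity (int p) b) - int (multiplicity (int p) a))"
proof -
  obtain c d where cd: "quotient_of (of_int a / of_int b) = (c, d)"
    by fastforce
  have d: "d > 0" and eq: "(of_int a / of_int b :: rat) = of_int c / of_int d"
    using quotient_of_denom_pos[OF cd] quotient_of_div[OF cd] by auto
  have c: "c \<noteq> 0" using eq assms by auto
  have "(of_int (a * d) :: rat) = of_int (c * b)"
    using eq d assms by (simp add: field_simps)
  then have "a * d = c * b" by (simp only: of_int_eq_iff)
  then have "multiplicity (int p) (a * d) = multiplicity (int p) (c * b)" by simp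
  then have "multiplicity (int p) a + multiplicity (int p) d
      = multiplicity (int p) c + multiplicity (int p) b"
    using assms c d
    by (simp add: prime_elem_multiplicity_mult_distrib[OF prime_elem_int_p])
  then have "int (multiplicity (int p) d) - int (multiplicity (int p) c) =
      int (multiplicity (int p) b) - int (multiplicity (int p) a)" by linarith
  then show ?thesis
    using assms cd unfolding padic_abs_rat_def by simp
qed

lemma rat_fraction:
  obtains a b where "(x::rat) = of_int a / of_int b" "b \<noteq> 0"
proof -
  obtain a b where ab: "quotient_of x = (a, b)" by fastforce
  show ?thesis
    using that[of a b] quotient_of_div[OF ab] quotient_of_denom_pos[OF ab] by simp
qed

lemma nrm_of_int:
  "a \<noteq> 0 \<Longrightarrow> nrm (of_int a) = real p powi (- int (multiplicity (int p) a))"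
  using nrm_fraction[of a 1] by simp

lemma nrm_value:
  assumes "x \<noteq> 0" shows "\<exists>k. nrm x = real p powi k"
proof -
  obtain a b where "x = of_int a / of_int b" "b \<noteq> 0" by (rule rat_fraction)
  then show ?thesis using assms nrm_fraction[of a b] by auto
qed

lemma nrm_eq_0_iff [simp]: "nrm x = 0 \<longleftrightarrow> x = 0"
proof (cases "x = 0")
  case False
  then obtain k where "nrm x = real p powi k" using nrm_value by blast
  then show ?thesis using False p_gt_1 by simp
qed simp

lemma nrm_nonneg [simp]: "nrm x \<ge> 0"
proof (cases "x = 0")
  case False
  then obtain k where "nrm x = real p powi k" using nrm_value by blast
  then show ?thesis by simp
qed simp

lemma nrm_pos: "x \<noteq> 0 \<Longrightarrow> nrm x > 0"
  using nrm_nonneg[of x] nrm_eq_0_iff[of x] by linarith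

lemma nrm_mult: "nrm (x * y) = nrm x * nrm y"
proof (cases "x = 0 \<or> y = 0")
  case False
  obtain a b where x: "x = of_int a / of_int b" "b \<noteq> 0" by (rule rat_fraction)
  obtain c d where y: "y = of_int c / of_int d" "d \<noteq> 0" by (rule rat_fraction)
  have nz: "a \<noteq> 0" "c \<noteq> 0" using x y False by auto
  have bd: "b * d \<noteq> 0" and ac: "a * c \<noteq> 0" using nz x(2) y(2) by auto
  have xy: "x * y = of_int (a * c) / of_int (b * d)" unfolding x(1) y(1) by simp
  have "int (multiplicity (int p) (b * d)) - int (multiplicity (int p) (a * c)) =
     (int (multiplicity (int p) b) - int (multiplicity (int p) a)) +
     (int (multiplicity (int p) d) - int (multiplicity (int p) c))"
    using prime_elem_multiplicity_mult_distrib[OF prime_elem_int_p x(2) y(2)]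
      prime_elem_multiplicity_mult_distrib[OF prime_elem_int_p nz] by linarith
  then show ?thesis
    unfolding xy nrm_fraction[OF ac bd]
    unfolding x(1) y(1) nrm_fraction[OF nz(1) x(2)] nrm_fraction[OF nz(2) y(2)]
    by (simp only: power_int_add[OF disjI1[OF real_p_nonzero]])
next
  case True
  then show ?thesis by (elim disjE) simp_all
qed

lemma nrm_1 [simp]: "nrm 1 = 1"
  using nrm_of_int[of 1] by simp

lemma nrm_minus [simp]: "nrm (- x) = nrm x"
proof -
  have "nrm (-1) = 1" using nrm_of_int[of "-1"] by simp
  then show ?thesis using nrm_mult[of "-1" x] by simp
qed

lemma nrm_diff_commute: "nrm (x - y) = nrm (y - x)"
  using nrm_minus[of "x - y"] by simp

lemma nrm_inverse: "nrm (inverse x) = inverse (nrm x)"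
proof (cases "x = 0")
  case False
  then have "nrm x * nrm (inverse x) = 1" by (simp flip: nrm_mult)
  then show ?thesis by (simp add: inverse_unique)
qed auto

lemma nrm_divide: "nrm (x / y) = nrm x / nrm y"
  by (simp add: divide_inverse nrm_mult nrm_inverse)

lemma nrm_of_int_le_iff:
  "nrm (of_int a) \<le> real p powi (- int k) \<longleftrightarrow> int p ^ k dvd a"
proof (cases "a = 0")
  case False
  have "\<not> is_unit (int p)" using prime_elem_int_p prime_elem_not_unit by blast
  then have "int p ^ k dvd a \<longleftrightarrow> k \<le> multiplicity (int p) a"
    using False by (subst power_dvd_iff_le_multiplicity) auto
  also have "\<dots> \<longleftrightarrow> nrm (of_int a) \<le> real p powi (- int k)"
    using False real_p_gt_1 power_int_increasing[of "- int (multiplicity (int p) a)" "- int k" "real p"]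
      power_int_strict_increasing[of "- int k" "- int (multiplicity (int p) a)" "real p"]
    by (auto simp: nrm_of_int not_le[symmetric])
  finally show ?thesis by simp
qed auto

lemma nrm_of_int_le_1: "nrm (of_int a) \<le> 1"
  using nrm_of_int_le_iff[of a 0] by simp

lemma nrm_p: "nrm (of_nat p) = 1 / real p"
  using nrm_of_int[of "int p"] p_gt_1 multiplicity_prime[OF prime_elem_int_p]
  by (simp add: power_int_minus inverse_eq_divide)

lemma nrm_power: "nrm (x ^ n) = nrm x ^ n"
  by (induction n) (auto simp: nrm_mult)

lemma nrm_p_powi: "nrm (of_nat p powi k) = real p powi (- k)"
  by (cases "k \<ge> 0")
     (auto simp: power_int_def nrm_power nrm_divide nrm_p inverse_eq_divide power_one_over)

text \<open>A \<open>p\<close>-integral rational has a denominator prime to \<open>p\<close>: in lowest terms, \<open>p\<close> cannot divide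
  both the numerator and the denominator.\<close>

lemma nrm_le_1_fraction:
  assumes "nrm z \<le> 1"
  obtains u v where "z = of_int u / of_int v" "v > 0" "\<not> int p dvd v" "nrm (of_int v) = 1"
proof -
  obtain u v where uv: "quotient_of z = (u, v)" by fastforce
  have v: "v > 0" "coprime u v" "z = of_int u / of_int v"
    using quotient_of_denom_pos[OF uv] quotient_of_div[OF uv] quotient_of_coprime[OF uv] by auto
  have pv: "\<not> int p dvd v"
  proof
    assume pd: "int p dvd v"
    then have "\<not> int p dvd u"
      using v(2) prime_elem_int_p by (meson coprime_common_divisor prime_elem_not_unit)
    then have "\<not> nrm (of_int u) \<le> 1 / real p"
      using nrm_of_int_le_iff[of u 1] by (simp add: power_int_minus inverse_eq_divide)
    moreover have "nrm (of_int v) \<le> 1 / real p"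
      using nrm_of_int_le_iff[of v 1] pd by (simp add: power_int_minus inverse_eq_divide)
    moreover have "nrm (of_int u) \<le> nrm (of_int v)"
      using assms v nrm_pos[of "of_int v"] by (simp add: nrm_divide divide_le_eq_1)
    ultimately show False by linarith
  qed
  then have "nrm (of_int v) = 1"
    using v(1) by (simp add: nrm_of_int not_dvd_imp_multiplicity_0)
  with v pv show ?thesis using that by blast
qed

lemma nrm_add_le:
  assumes "nrm x \<le> r" "nrm y \<le> r"
  shows "nrm (x + y) \<le> r"
proof (cases "x + y = 0 \<or> x = 0 \<or> y = 0")
  case True
  then show ?thesis using assms order_trans[OF nrm_nonneg assms(1)] by auto
next
  case False
  have *: "nrm (x + y) \<le> r" if le: "nrm x \<le> nrm y" and y: "y \<noteq> 0" "nrm y \<le> r" for x y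
  proof -
    \<comment> \<open>Dividing by the larger summand reduces the claim to: if the quotient z is p-integral,
        then so is z + 1.\<close>
    define z where "z = x / y"
    have z: "nrm z \<le> 1" using le y by (simp add: z_def nrm_divide divide_le_eq_1 nrm_pos)
    have "nrm (z + 1) \<le> 1"
    proof -
      obtain c d where d: "z = of_int c / of_int d" "d > 0" "nrm (of_int d) = 1"
        using nrm_le_1_fraction[OF z] by metis
      have "z + 1 = of_int (c + d) / of_int d" using d by (simp add: field_simps)
      then show ?thesis using nrm_of_int_le_1[of "c + d"] d(3) by (simp add: nrm_divide)
    qed
    moreover have "x + y = (z + 1) * y" using y by (simp add: z_def field_simps)
    ultimately have "nrm (x + y) \<le> 1 * nrm y"
      unfolding nrm_mult by (metis mult_right_mono nrm_mult nrm_nonneg)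
    then show ?thesis using y by simp
  qed
  show ?thesis
    using *[of x y] *[of y x] assms False by (cases "nrm x \<le> nrm y") (auto simp: add.commute)
qed

lemma nrm_add: "nrm (x + y) \<le> max (nrm x) (nrm y)"
  by (rule nrm_add_le) auto

lemma nrm_diff: "nrm (x - y) \<le> max (nrm x) (nrm y)"
  using nrm_add[of x "- y"] by simp

lemma nrm_triangle: "nrm (x + y) \<le> nrm x + nrm y"
  using nrm_add[of x y] nrm_nonneg[of x] nrm_nonneg[of y] by linarith

lemma nrm_isosceles: "nrm (x - y) < nrm y \<Longrightarrow> nrm x = nrm y"
  using nrm_add[of "x - y" y] nrm_diff[of x "x - y"] by (auto simp: max_def split: if_splits)

text \<open>Every \<open>p\<close>-integral rational is congruent modulo \<open>p\<close> to a digit, namely its numerator times an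
  inverse of its denominator. The statement is scaled by \<open>p powi m\<close>.\<close>

lemma rat_digit:
  assumes "nrm x \<le> real p powi (- m)"
  obtains c :: nat where "c < p" "nrm (x - of_nat c * of_nat p powi m) \<le> real p powi (- (m + 1))"
proof -
  define z where "z = x / of_nat p powi m"
  have p0: "(of_nat p :: rat) \<noteq> 0" "real p > 0" using p_gt_1 by auto
  have x: "x = z * of_nat p powi m" using p0 by (simp add: z_def)
  have z: "nrm z \<le> 1"
    using assms p0 by (simp add: z_def nrm_divide nrm_p_powi divide_le_eq_1)
  obtain u v where v: "z = of_int u / of_int v" "v > 0"
    and pv: "\<not> int p dvd v" and nv: "nrm (of_int v) = 1"
    using nrm_le_1_fraction[OF z] by metis
  have "coprime v (int p)"
    using pv prime_elem_int_p by (metis coprime_commute prime_elem_imp_coprime)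
  then obtain w where w: "[v * w = 1] (mod int p)" using cong_solve_coprime_int by blast
  define c where "c = nat ((u * w) mod int p)"
  have c: "int c = (u * w) mod int p" "c < p"
    using p_gt_1 by (auto simp: c_def nat_less_iff)
  have "[v * int c = v * (u * w)] (mod int p)" using c by (simp add: cong_def mod_mult_right_eq)
  also have "v * (u * w) = u * (v * w)" by simp
  also have "[u * (v * w) = u * 1] (mod int p)" using w by (rule cong_mult[OF cong_refl])
  finally have "int p dvd u - v * int c"
    by (metis cong_iff_dvd_diff cong_sym mult.right_neutral)
  then have "nrm (of_int (u - v * int c)) \<le> 1 / real p"
    using nrm_of_int_le_iff[of "u - v * int c" 1] by (simp add: power_int_minus inverse_eq_divide)
  moreover have "z - of_nat c = of_int (u - v * int c) / of_int v"
    using v by (simp add: field_simps)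
  ultimately have "nrm (z - of_nat c) \<le> 1 / real p" using nv by (simp add: nrm_divide)
  moreover have "x - of_nat c * of_nat p powi m = (z - of_nat c) * of_nat p powi m"
    using x by (simp add: algebra_simps)
  ultimately have "nrm (x - of_nat c * of_nat p powi m) \<le> 1 / real p * real p powi (- m)"
    using p0 by (simp only: nrm_mult nrm_p_powi) (intro mult_right_mono, auto)
  also have "\<dots> = real p powi (- (m + 1))"
    using p0 by (simp add: power_int_diff power_int_minus field_simps power_int_add)
  finally show ?thesis using that c(2) by blast
qed

section \<open>Cauchy sequences and the field of p-adic numbers\<close>

text \<open>\<open>R\<close> is the ring of Cauchy sequences.\<close>

abbreviation cauchy where "cauchy \<equiv> padic_cauchy p"
abbreviation null where "null \<equiv> padic_null p"
abbreviation R where "R \<equiv> padic_cauchy_ring p"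

lemma cauchyE:
  assumes "cauchy X" "e > 0"
  obtains N where "\<And>m n. m \<ge> N \<Longrightarrow> n \<ge> N \<Longrightarrow> nrm (X m - X n) < e"
  using assms unfolding padic_cauchy_def by meson

lemma nullE:
  assumes "X \<in> null" "e > 0"
  obtains N where "\<And>n. n \<ge> N \<Longrightarrow> nrm (X n) < e"
  using assms unfolding padic_null_def by (auto simp: lim_sequentially)

lemma nullI:
  assumes "\<And>e. e > 0 \<Longrightarrow> \<exists>N. \<forall>n\<ge>N. nrm (X n) < e"
  shows "X \<in> null"
  using assms unfolding padic_null_def by (auto simp: lim_sequentially)

lemma cauchy_const: "cauchy (\<lambda>n. q)"
  by (simp add: padic_cauchy_def)

lemma cauchy_add:
  assumes "cauchy X" "cauchy Y" shows "cauchy (\<lambda>n. X n + Y n)"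
  unfolding padic_cauchy_def
proof (intro allI impI)
  fix e :: real assume e: "e > 0"
  obtain N where N: "\<And>m n. m \<ge> N \<Longrightarrow> n \<ge> N \<Longrightarrow> nrm (X m - X n) < e"
    using cauchyE[OF assms(1) e] by metis
  obtain M where M: "\<And>m n. m \<ge> M \<Longrightarrow> n \<ge> M \<Longrightarrow> nrm (Y m - Y n) < e"
    using cauchyE[OF assms(2) e] by metis
  have "nrm (X m + Y m - (X n + Y n)) < e" if "m \<ge> max N M" "n \<ge> max N M" for m n
    using nrm_add[of "X m - X n" "Y m - Y n"] N[of m n] M[of m n] that
    by (simp add: algebra_simps)
  then show "\<exists>N. \<forall>m\<ge>N. \<forall>n\<ge>N. nrm (X m + Y m - (X n + Y n)) < e" by blast
qed

lemma cauchy_minus: "cauchy X \<Longrightarrow> cauchy (\<lambda>n. - X n)"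
  by (simp add: padic_cauchy_def nrm_diff_commute)

lemma cauchy_bounded:
  assumes "cauchy X"
  obtains B where "B > 0" "\<And>n. nrm (X n) \<le> B"
proof -
  obtain N where N: "\<And>m n. m \<ge> N \<Longrightarrow> n \<ge> N \<Longrightarrow> nrm (X m - X n) < 1"
    using cauchyE[OF assms zero_less_one] by metis
  define B where "B = 1 + (\<Sum>n\<le>N. nrm (X n))"
  have *: "nrm (X n) \<le> (\<Sum>n\<le>N. nrm (X n))" if "n \<le> N" for n
    using that by (intro member_le_sum) auto
  have "B > 0" unfolding B_def by (intro add_pos_nonneg sum_nonneg) auto
  moreover have "nrm (X n) \<le> B" for n
  proof (cases "n \<le> N")
    case True
    then show ?thesis using *[of n] by (simp add: B_def)
  next
    case False
    then show ?thesis
      using nrm_triangle[of "X n - X N" "X N"] N[of n N] *[of N] by (simp add: B_def)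
  qed
  ultimately show ?thesis using that by blast
qed

lemma null_mult:
  assumes "cauchy X" "Y \<in> null" shows "(\<lambda>n. X n * Y n) \<in> null"
proof (rule nullI)
  fix e :: real assume e: "e > 0"
  obtain B where B: "B > 0" "\<And>n. nrm (X n) \<le> B" using cauchy_bounded[OF assms(1)] by metis
  obtain N where N: "\<And>n. n \<ge> N \<Longrightarrow> nrm (Y n) < e / B"
    using nullE[OF assms(2), of "e / B"] e B by auto
  have "nrm (X n * Y n) < e" if "n \<ge> N" for n
  proof -
    have "nrm (X n * Y n) \<le> B * nrm (Y n)" using B by (simp add: nrm_mult mult_right_mono)
    also have "\<dots> < e" using N[OF that] B by (simp add: field_simps)
    finally show ?thesis .
  qed
  then show "\<exists>N. \<forall>n\<ge>N. nrm (X n * Y n) < e" by blast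
qed

lemma cauchy_mult:
  assumes "cauchy X" "cauchy Y" shows "cauchy (\<lambda>n. X n * Y n)"
  unfolding padic_cauchy_def
proof (intro allI impI)
  fix e :: real assume e: "e > 0"
  obtain B where B: "B > 0" "\<And>n. nrm (X n) \<le> B" using cauchy_bounded[OF assms(1)] by metis
  obtain B' where B': "B' > 0" "\<And>n. nrm (Y n) \<le> B'" using cauchy_bounded[OF assms(2)] by metis
  obtain N where N: "\<And>m n. m \<ge> N \<Longrightarrow> n \<ge> N \<Longrightarrow> nrm (X m - X n) < e / B'"
    using cauchyE[OF assms(1), of "e / B'"] e B' by (metis divide_pos_pos)
  obtain M where M: "\<And>m n. m \<ge> M \<Longrightarrow> n \<ge> M \<Longrightarrow> nrm (Y m - Y n) < e / B"
    using cauchyE[OF assms(2), of "e / B"] e B by (metis divide_pos_pos)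
  have "nrm (X m * Y m - X n * Y n) < e" if mn: "m \<ge> max N M" "n \<ge> max N M" for m n
  proof -
    have "nrm (X m * (Y m - Y n)) \<le> B * nrm (Y m - Y n)"
      using B by (simp add: nrm_mult mult_right_mono)
    also have "\<dots> < e" using M[of m n] mn B by (simp add: field_simps)
    finally have 1: "nrm (X m * (Y m - Y n)) < e" .
    have "nrm ((X m - X n) * Y n) \<le> nrm (X m - X n) * B'"
      using B' by (simp add: nrm_mult mult_left_mono)
    also have "\<dots> < e" using N[of m n] mn B' by (simp add: field_simps)
    finally have 2: "nrm ((X m - X n) * Y n) < e" .
    have "X m * Y m - X n * Y n = X m * (Y m - Y n) + (X m - X n) * Y n"
      by (simp add: algebra_simps)
    then show ?thesis using 1 2 nrm_add[of "X m * (Y m - Y n)" "(X m - X n) * Y n"] by simp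
  qed
  then show "\<exists>N. \<forall>m\<ge>N. \<forall>n\<ge>N. nrm (X m * Y m - X n * Y n) < e" by blast
qed

lemma null_add:
  assumes "X \<in> null" "Y \<in> null" shows "(\<lambda>n. X n + Y n) \<in> null"
proof (rule nullI)
  fix e :: real assume e: "e > 0"
  obtain N where N: "\<And>n. n \<ge> N \<Longrightarrow> nrm (X n) < e" using nullE[OF assms(1) e] by metis
  obtain M where M: "\<And>n. n \<ge> M \<Longrightarrow> nrm (Y n) < e" using nullE[OF assms(2) e] by metis
  have "nrm (X n + Y n) < e" if "n \<ge> max N M" for n
    using nrm_add[of "X n" "Y n"] N[of n] M[of n] that by simp
  then show "\<exists>N. \<forall>n\<ge>N. nrm (X n + Y n) < e" by blast
qed

lemma null_minus: "X \<in> null \<Longrightarrow> (\<lambda>n. - X n) \<in> null"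
  by (simp add: padic_null_def)

lemma null_imp_cauchy:
  assumes "X \<in> null" shows "cauchy X"
  unfolding padic_cauchy_def
proof (intro allI impI)
  fix e :: real assume e: "e > 0"
  obtain N where N: "\<And>n. n \<ge> N \<Longrightarrow> nrm (X n) < e" using nullE[OF assms e] by metis
  have "nrm (X m - X n) < e" if "m \<ge> N" "n \<ge> N" for m n
    using nrm_diff[of "X m" "X n"] N[of m] N[of n] that by simp
  then show "\<exists>N. \<forall>m\<ge>N. \<forall>n\<ge>N. nrm (X m - X n) < e" by blast
qed

text \<open>By the isosceles property, the absolute value is eventually constant on a Cauchy sequence that
  is not null. Hence inverses exist, and the value group of the completion is still \<open>p powi \<int>\<close>.\<close>

lemma cauchy_not_null_eventually_const:
  assumes X: "cauchy X" "X \<notin> null"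
  obtains k N where "\<And>n. n \<ge> N \<Longrightarrow> nrm (X n) = real p powi k"
proof -
  obtain e where e: "e > 0" "\<And>N. \<exists>n\<ge>N. \<not> nrm (X n) < e"
    using X(2) nullI[of X] by blast
  obtain N where N: "\<And>m n. m \<ge> N \<Longrightarrow> n \<ge> N \<Longrightarrow> nrm (X m - X n) < e"
    using cauchyE[OF X(1) e(1)] by metis
  obtain n0 where n0: "n0 \<ge> N" "nrm (X n0) \<ge> e" using e(2)[of N] by (auto simp: not_less)
  have "nrm (X n) = nrm (X n0)" if "n \<ge> N" for n
    using N[OF that n0(1)] n0 by (intro nrm_isosceles) auto
  moreover obtain k where "nrm (X n0) = real p powi k"
    using nrm_value[of "X n0"] n0 e(1) by fastforce
  ultimately show ?thesis using that[of N k] by simp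
qed

lemma cauchy_nrm_convergent:
  assumes "cauchy X" obtains L where "(\<lambda>n. nrm (X n)) \<longlonglongrightarrow> L"
proof (cases "X \<in> null")
  case True
  then show ?thesis using that by (simp add: padic_null_def)
next
  case False
  obtain k N where "\<And>n. n \<ge> N \<Longrightarrow> nrm (X n) = real p powi k"
    by (rule cauchy_not_null_eventually_const[OF assms False]) blast
  then have "(\<lambda>n. nrm (X n)) \<longlonglongrightarrow> real p powi k"
    by (intro tendsto_eventually) (auto simp: eventually_sequentially)
  then show ?thesis using that by blast
qed

lemma cauchy_inverse:
  assumes X: "cauchy X" "X \<notin> null"
  shows "cauchy (\<lambda>n. inverse (X n))"
  unfolding padic_cauchy_def
proof (intro allI impI)
  fix e :: real assume e: "e > 0"
  obtain k M where M: "\<And>n. n \<ge> M \<Longrightarrow> nrm (X n) = real p powi k"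
    by (rule cauchy_not_null_eventually_const[OF X]) blast
  define r where "r = real p powi k"
  have r: "r > 0" using p_gt_1 by (simp add: r_def)
  then have "e * r\<^sup>2 > 0" using e by simp
  then obtain N where N: "\<And>m n. m \<ge> N \<Longrightarrow> n \<ge> N \<Longrightarrow> nrm (X m - X n) < e * r\<^sup>2"
    using cauchyE[OF X(1)] by metis
  have "nrm (inverse (X m) - inverse (X n)) < e" if "m \<ge> max N M" "n \<ge> max N M" for m n
  proof -
    have nr: "nrm (X m) = r" "nrm (X n) = r" using M that by (auto simp: r_def)
    then have nz: "X m \<noteq> 0" "X n \<noteq> 0" using r by auto
    then have "inverse (X m) - inverse (X n) = (X n - X m) / (X m * X n)"
      by (simp add: field_simps)
    then have "nrm (inverse (X m) - inverse (X n)) = nrm (X n - X m) / r\<^sup>2"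
      using nr by (simp add: nrm_divide nrm_mult power2_eq_square)
    also have "\<dots> < e" using N[of n m] that r by (simp add: field_simps)
    finally show ?thesis .
  qed
  then show "\<exists>N. \<forall>m\<ge>N. \<forall>n\<ge>N. nrm (inverse (X m) - inverse (X n)) < e" by blast
qed

lemma R_simps [simp]:
  "carrier R = {X. cauchy X}" "X \<otimes>\<^bsub>R\<^esub> Y = (\<lambda>n. X n * Y n)" "X \<oplus>\<^bsub>R\<^esub> Y = (\<lambda>n. X n + Y n)"
  "\<one>\<^bsub>R\<^esub> = (\<lambda>n. 1)" "\<zero>\<^bsub>R\<^esub> = (\<lambda>n. 0)"
  by (auto simp: padic_cauchy_ring_def)

lemma R_cring: "cring R"
proof (rule cringI)
  show "abelian_group R"
  proof (rule abelian_groupI)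
    fix X assume "X \<in> carrier R"
    then show "\<exists>Y\<in>carrier R. Y \<oplus>\<^bsub>R\<^esub> X = \<zero>\<^bsub>R\<^esub>"
      by (intro bexI[of _ "\<lambda>n. - X n"]) (auto intro: cauchy_minus)
  qed (auto simp: add_ac intro: cauchy_add cauchy_const)
  show "comm_monoid R"
    by (rule comm_monoidI) (auto simp: mult_ac intro: cauchy_mult cauchy_const)
qed (auto simp: algebra_simps)

sublocale R: cring R by (rule R_cring)

lemma R_uminus: "cauchy X \<Longrightarrow> \<ominus>\<^bsub>R\<^esub> X = (\<lambda>n. - X n)"
  by (rule R.minus_equality) (auto intro: cauchy_minus)

lemma R_minus: "cauchy X \<Longrightarrow> cauchy Y \<Longrightarrow> X \<ominus>\<^bsub>R\<^esub> Y = (\<lambda>n. X n - Y n)"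
  by (simp add: a_minus_def R_uminus)

lemma null_ideal: "ideal null R"
proof (rule idealI)
  show "ring R" by (rule R.ring_axioms)
  show "subgroup null (add_monoid R)"
  proof
    show "null \<subseteq> carrier (add_monoid R)" using null_imp_cauchy by auto
    show "\<one>\<^bsub>add_monoid R\<^esub> \<in> null" by (simp add: padic_null_def)
    fix X assume X: "X \<in> null"
    have "inv\<^bsub>add_monoid R\<^esub> X = (\<lambda>n. - X n)"
      using R_uminus[OF null_imp_cauchy[OF X]] by (simp add: a_inv_def)
    then show "inv\<^bsub>add_monoid R\<^esub> X \<in> null" using null_minus[OF X] by simp
  qed (auto intro: null_add)
next
  fix a x assume "a \<in> null" "x \<in> carrier R"
  then have *: "(\<lambda>n. x n * a n) \<in> null" by (simp add: null_mult)
  show "x \<otimes>\<^bsub>R\<^esub> a \<in> null" using * by simp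
  show "a \<otimes>\<^bsub>R\<^esub> x \<in> null" using * by (simp add: mult.commute)
qed

sublocale N: ideal null R by (rule null_ideal)

text \<open>\<open>K\<close> is the field of \<open>p\<close>-adic numbers, \<open>\<iota>\<close> the embedding of the rationals, and \<open>absp\<close> the
  absolute value of \<open>K\<close>.\<close>

abbreviation K where "K \<equiv> Qp p"
abbreviation \<iota> where "\<iota> \<equiv> Qp_of_rat p"
abbreviation absp where "absp \<equiv> Qp_abs p"

text \<open>The \<open>p\<close>-adic number represented by a Cauchy sequence.\<close>

definition cls :: "(nat \<Rightarrow> rat) \<Rightarrow> (nat \<Rightarrow> rat) set" where
  "cls X = null +>\<^bsub>R\<^esub> X"

lemma K_cring: "cring K"
  unfolding Qp_def by (rule N.quotient_is_cring[OF R_cring])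

sublocale K: cring K by (rule K_cring)

lemma cls_hom: "ring_hom_cring R K cls"
  unfolding Qp_def cls_def[abs_def] by (rule N.rcos_ring_hom_cring[OF R_cring])

sublocale cls: ring_hom_cring R K cls by (rule cls_hom)

lemma cls_closed: "cauchy X \<Longrightarrow> cls X \<in> carrier K"
  using cls.hom_closed by simp

lemma carrier_K_E:
  assumes "a \<in> carrier K" obtains X where "cauchy X" "a = cls X"
  using assms by (auto simp: Qp_def FactRing_def A_RCOSETS_defs cls_def a_r_coset_def)

lemma cls_eq_iff:
  assumes "cauchy X" "cauchy Y" shows "cls X = cls Y \<longleftrightarrow> (\<lambda>n. X n - Y n) \<in> null"
  using R.quotient_eq_iff_same_a_r_cos[OF null_ideal, of X Y] assms by (simp add: cls_def R_minus)

lemma mem_cls_iff: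
  assumes "cauchy X" shows "Y \<in> cls X \<longleftrightarrow> cauchy Y \<and> (\<lambda>n. Y n - X n) \<in> null"
proof -
  have "Y \<in> cls X \<longleftrightarrow> (\<exists>h\<in>null. Y = (\<lambda>n. h n + X n))"
    by (auto simp: cls_def a_r_coset_def')
  also have "\<dots> \<longleftrightarrow> cauchy Y \<and> (\<lambda>n. Y n - X n) \<in> null"
  proof safe
    fix h assume h: "h \<in> null"
    show "cauchy (\<lambda>n. h n + X n)" by (rule cauchy_add[OF null_imp_cauchy[OF h] assms])
    show "(\<lambda>n. h n + X n - X n) \<in> null" using h by simp
  next
    assume "(\<lambda>n. Y n - X n) \<in> null"
    then show "\<exists>h\<in>null. Y = (\<lambda>n. h n + X n)" by (intro bexI[of _ "\<lambda>n. Y n - X n"]) auto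
  qed
  finally show ?thesis .
qed

lemma cls_add: "cauchy X \<Longrightarrow> cauchy Y \<Longrightarrow> cls X \<oplus>\<^bsub>K\<^esub> cls Y = cls (\<lambda>n. X n + Y n)"
  using cls.hom_add[of X Y] by simp
lemma cls_mult: "cauchy X \<Longrightarrow> cauchy Y \<Longrightarrow> cls X \<otimes>\<^bsub>K\<^esub> cls Y = cls (\<lambda>n. X n * Y n)"
  using cls.hom_mult[of X Y] by simp
lemma cls_minus: "cauchy X \<Longrightarrow> cauchy Y \<Longrightarrow> cls X \<ominus>\<^bsub>K\<^esub> cls Y = cls (\<lambda>n. X n - Y n)"
  by (simp add: a_minus_def cls_add cauchy_minus R_uminus flip: cls.hom_a_inv)
lemma cls_one: "\<one>\<^bsub>K\<^esub> = cls (\<lambda>n. 1)"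
  using cls.hom_one by simp
lemma cls_zero: "\<zero>\<^bsub>K\<^esub> = cls (\<lambda>n. 0)"
  using cls.hom_zero by simp

lemma \<iota>_eq_cls: "\<iota> q = cls (\<lambda>n. q)"
  by (simp add: Qp_of_rat_def cls_def)

lemma cls_eq_zero_iff: "cauchy X \<Longrightarrow> cls X = \<zero>\<^bsub>K\<^esub> \<longleftrightarrow> X \<in> null"
  by (simp add: cls_zero cls_eq_iff cauchy_const)

lemma \<iota>_closed [simp, intro]: "\<iota> q \<in> carrier K"
  by (simp add: \<iota>_eq_cls cls_closed cauchy_const)

lemma \<iota>_add: "\<iota> (x + y) = \<iota> x \<oplus>\<^bsub>K\<^esub> \<iota> y"
  by (simp add: \<iota>_eq_cls cls_add cauchy_const)
lemma \<iota>_mult: "\<iota> (x * y) = \<iota> x \<otimes>\<^bsub>K\<^esub> \<iota> y"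
  by (simp add: \<iota>_eq_cls cls_mult cauchy_const)
lemma \<iota>_diff: "\<iota> (x - y) = \<iota> x \<ominus>\<^bsub>K\<^esub> \<iota> y"
  by (simp add: \<iota>_eq_cls cls_minus cauchy_const)
lemma \<iota>_0: "\<iota> 0 = \<zero>\<^bsub>K\<^esub>"
  by (simp add: \<iota>_eq_cls cls_zero)
lemma \<iota>_1: "\<iota> 1 = \<one>\<^bsub>K\<^esub>"
  by (simp add: \<iota>_eq_cls cls_one)

text \<open>Every representative of the coset has the same limit, because it differs from \<open>X\<close> by a null
  sequence.\<close>

lemma absp_cls:
  assumes "cauchy X" "(\<lambda>n. nrm (X n)) \<longlonglongrightarrow> L"
  shows "absp (cls X) = L"
  unfolding Qp_abs_def
proof (rule the_equality)
  show "\<exists>Y\<in>cls X. (\<lambda>n. nrm (Y n)) \<longlonglongrightarrow> L"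
    using assms by (intro bexI[of _ X]) (auto simp: mem_cls_iff padic_null_def)
next
  fix r assume "\<exists>Y\<in>cls X. (\<lambda>n. nrm (Y n)) \<longlonglongrightarrow> r"
  then obtain Y where Y: "(\<lambda>n. Y n - X n) \<in> null" "(\<lambda>n. nrm (Y n)) \<longlonglongrightarrow> r"
    using assms(1) by (auto simp: mem_cls_iff)
  have "\<bar>nrm (Y n) - nrm (X n)\<bar> \<le> nrm (Y n - X n)" for n
    using nrm_triangle[of "Y n - X n" "X n"] nrm_triangle[of "X n - Y n" "Y n"]
      nrm_diff_commute[of "X n" "Y n"] by simp
  then have "(\<lambda>n. nrm (Y n) - nrm (X n)) \<longlonglongrightarrow> 0"
    using Y(1) unfolding padic_null_def
    by (elim CollectE tendsto_0_le[where K = 1]) simp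
  moreover have "(\<lambda>n. nrm (Y n) - nrm (X n)) \<longlonglongrightarrow> r - L"
    using Y(2) assms(2) by (rule tendsto_diff)
  ultimately show "r = L" using LIMSEQ_unique by fastforce
qed

lemma absp_lim:
  assumes "cauchy X" shows "(\<lambda>n. nrm (X n)) \<longlonglongrightarrow> absp (cls X)"
proof -
  obtain L where "(\<lambda>n. nrm (X n)) \<longlonglongrightarrow> L" by (rule cauchy_nrm_convergent[OF assms])
  with absp_cls[OF assms this] show ?thesis by simp
qed

lemma absp_\<iota>: "absp (\<iota> q) = nrm q"
  unfolding \<iota>_eq_cls by (rule absp_cls) (auto intro: cauchy_const)

lemma absp_zero [simp]: "absp \<zero>\<^bsub>K\<^esub> = 0"
  using absp_\<iota>[of 0] by (simp add: \<iota>_0)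

lemma absp_nonneg: "a \<in> carrier K \<Longrightarrow> absp a \<ge> 0"
proof (elim carrier_K_E)
  fix X assume X: "cauchy X" "a = cls X"
  show "absp a \<ge> 0"
    unfolding X(2) by (rule LIMSEQ_le_const[OF absp_lim[OF X(1)]]) auto
qed

lemma absp_eq_0_iff: "a \<in> carrier K \<Longrightarrow> absp a = 0 \<longleftrightarrow> a = \<zero>\<^bsub>K\<^esub>"
proof (elim carrier_K_E)
  fix X assume X: "cauchy X" "a = cls X"
  show "absp a = 0 \<longleftrightarrow> a = \<zero>\<^bsub>K\<^esub>"
    unfolding X(2) cls_eq_zero_iff[OF X(1)]
  proof
    assume "absp (cls X) = 0"
    then show "X \<in> null" using absp_lim[OF X(1)] by (simp add: padic_null_def)
  next
    assume "X \<in> null"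
    then show "absp (cls X) = 0" using X(1) by (intro absp_cls) (simp_all add: padic_null_def)
  qed
qed

lemma absp_value:
  assumes "a \<in> carrier K" "a \<noteq> \<zero>\<^bsub>K\<^esub>" obtains k where "absp a = real p powi k"
proof -
  obtain X where X: "cauchy X" "a = cls X" using assms(1) by (rule carrier_K_E)
  then have nn: "X \<notin> null" using assms(2) cls_eq_zero_iff by blast
  obtain k N where "\<And>n. n \<ge> N \<Longrightarrow> nrm (X n) = real p powi k"
    by (rule cauchy_not_null_eventually_const[OF X(1) nn]) blast
  then have "(\<lambda>n. nrm (X n)) \<longlonglongrightarrow> real p powi k"
    by (intro tendsto_eventually) (auto simp: eventually_sequentially)
  from absp_cls[OF X(1) this] show ?thesis using that X(2) by blast
qed

lemma absp_mult:
  assumes "a \<in> carrier K" "b \<in> carrier K" shows "absp (a \<otimes>\<^bsub>K\<^esub> b) = absp a * absp b"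
proof -
  obtain X where X: "cauchy X" "a = cls X" using assms(1) by (rule carrier_K_E)
  obtain Y where Y: "cauchy Y" "b = cls Y" using assms(2) by (rule carrier_K_E)
  have "(\<lambda>n. nrm (X n * Y n)) \<longlonglongrightarrow> absp (cls X) * absp (cls Y)"
    unfolding nrm_mult by (rule tendsto_mult[OF absp_lim[OF X(1)] absp_lim[OF Y(1)]])
  from absp_cls[OF cauchy_mult[OF X(1) Y(1)] this] show ?thesis
    unfolding X(2) Y(2) cls_mult[OF X(1) Y(1)] .
qed

lemma absp_diff:
  assumes "a \<in> carrier K" "b \<in> carrier K" shows "absp (a \<ominus>\<^bsub>K\<^esub> b) \<le> max (absp a) (absp b)"
proof -
  obtain X where X: "cauchy X" "a = cls X" using assms(1) by (rule carrier_K_E)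
  obtain Y where Y: "cauchy Y" "b = cls Y" using assms(2) by (rule carrier_K_E)
  have c: "cauchy (\<lambda>n. X n - Y n)" using cauchy_add[OF X(1) cauchy_minus[OF Y(1)]] by simp
  show ?thesis
    unfolding X(2) Y(2) cls_minus[OF X(1) Y(1)]
    by (rule LIMSEQ_le[OF absp_lim[OF c] tendsto_max[OF absp_lim[OF X(1)] absp_lim[OF Y(1)]]])
       (auto intro: nrm_diff)
qed

lemma K_field: "field K"
proof (rule K.cring_fieldI2)
  have "absp \<one>\<^bsub>K\<^esub> = 1" using absp_\<iota>[of 1] by (simp add: \<iota>_1)
  then show "\<zero>\<^bsub>K\<^esub> \<noteq> \<one>\<^bsub>K\<^esub>" using absp_zero by force
next
  fix a assume a: "a \<in> carrier K" "a \<noteq> \<zero>\<^bsub>K\<^esub>"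
  obtain X where X: "cauchy X" "a = cls X" using a(1) by (rule carrier_K_E)
  then have nn: "X \<notin> null" using a(2) cls_eq_zero_iff by blast
  obtain k N where N: "\<And>n. n \<ge> N \<Longrightarrow> nrm (X n) = real p powi k"
    by (rule cauchy_not_null_eventually_const[OF X(1) nn]) blast
  have "X n \<noteq> 0" if "n \<ge> N" for n using N[OF that] p_gt_1 by auto
  then have "(\<lambda>n. X n * inverse (X n) - 1) \<in> null"
    by (intro nullI exI[of _ N]) auto
  then have "a \<otimes>\<^bsub>K\<^esub> cls (\<lambda>n. inverse (X n)) = \<one>\<^bsub>K\<^esub>"
    using X nn by (simp add: cls_mult cls_one cls_eq_iff cauchy_inverse cauchy_mult cauchy_const)
  then show "\<exists>b\<in>carrier K. a \<otimes>\<^bsub>K\<^esub> b = \<one>\<^bsub>K\<^esub>"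
    using cls_closed[OF cauchy_inverse[OF X(1) nn]] by blast
qed

sublocale K: field K by (rule K_field)

lemma rat_approx:
  assumes "a \<in> carrier K" "e > 0"
  obtains q where "absp (a \<ominus>\<^bsub>K\<^esub> \<iota> q) \<le> e"
proof -
  obtain X where X: "cauchy X" "a = cls X" using assms(1) by (rule carrier_K_E)
  obtain N where N: "\<And>m n. m \<ge> N \<Longrightarrow> n \<ge> N \<Longrightarrow> nrm (X m - X n) < e"
    using cauchyE[OF X(1) assms(2)] by metis
  have c: "cauchy (\<lambda>n. X n - X N)" using cauchy_add[OF X(1) cauchy_const[of "- X N"]] by simp
  have "absp (a \<ominus>\<^bsub>K\<^esub> \<iota> (X N)) \<le> e"
    unfolding X(2) \<iota>_eq_cls cls_minus[OF X(1) cauchy_const]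
    using N by (intro LIMSEQ_le_const2[OF absp_lim[OF c]]) (auto intro!: exI[of _ N] less_imp_le)
  then show ?thesis using that by blast
qed

section \<open>Existence and uniqueness of the p-adic floor\<close>

lemma powi_p_mono: "i \<le> j \<Longrightarrow> real p powi i \<le> real p powi j"
  using p_gt_1 by (intro power_int_increasing) auto

lemma powi_p_less_imp: "real p powi i < real p powi j \<Longrightarrow> i < j"
  using powi_p_mono[of j i] by (meson not_le)

lemma absp_less_1:
  assumes "a \<in> carrier K" "absp a < 1" shows "absp a \<le> 1 / real p"
proof (cases "a = \<zero>\<^bsub>K\<^esub>")
  case False
  obtain k where k: "absp a = real p powi k" by (rule absp_value[OF assms(1) False])
  then have "real p powi k < real p powi 0" using assms(2) by simp
  then have "k \<le> -1" using powi_p_less_imp by fastforce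
  then show ?thesis using powi_p_mono[of k "-1"] k
    by (simp add: power_int_minus inverse_eq_divide)
qed simp

lemma \<iota>_eq_iff [simp]: "\<iota> x = \<iota> y \<longleftrightarrow> x = y"
proof
  assume "\<iota> x = \<iota> y"
  then have "\<iota> (x - y) = \<zero>\<^bsub>K\<^esub>" by (simp add: \<iota>_diff)
  then show "x = y" using absp_\<iota>[of "x - y"] by simp
qed simp

lemma absp_diff_le:
  "a \<in> carrier K \<Longrightarrow> b \<in> carrier K \<Longrightarrow> absp a \<le> r \<Longrightarrow> absp b \<le> r \<Longrightarrow> absp (a \<ominus>\<^bsub>K\<^esub> b) \<le> r"
  using absp_diff[of a b] by linarith

lemma absp_minus_\<iota>_le:
  assumes "a \<in> carrier K" "absp (a \<ominus>\<^bsub>K\<^esub> \<iota> q) \<le> r" "nrm (q - q') \<le> r"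
  shows "absp (a \<ominus>\<^bsub>K\<^esub> \<iota> q') \<le> r"
proof -
  have "a \<ominus>\<^bsub>K\<^esub> \<iota> q' = (a \<ominus>\<^bsub>K\<^esub> \<iota> q) \<ominus>\<^bsub>K\<^esub> \<iota> (q' - q)"
    using assms(1) by (simp add: \<iota>_diff K.minus_minus_cancel)
  moreover have "absp (\<iota> (q' - q)) \<le> r" using assms(3) nrm_diff_commute[of q q'] by (simp add: absp_\<iota>)
  ultimately show ?thesis using assms(1,2) by (simp add: absp_diff_le)
qed

text \<open>An approximation of \<open>a\<close> to order \<open>m\<close> extends by one digit, by density of the rationals.\<close>

lemma next_digit:
  assumes "a \<in> carrier K" "absp (a \<ominus>\<^bsub>K\<^esub> \<iota> t) \<le> real p powi (- m)"
  obtains c where "c < p"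
    "absp (a \<ominus>\<^bsub>K\<^esub> \<iota> (t + of_nat c * of_nat p powi m)) \<le> real p powi (- (m + 1))"
proof -
  let ?e = "real p powi (- (m + 1))"
  have "?e > 0" using p_gt_1 by simp
  then obtain q where q: "absp (a \<ominus>\<^bsub>K\<^esub> \<iota> q) \<le> ?e" by (rule rat_approx[OF assms(1)])
  have "(a \<ominus>\<^bsub>K\<^esub> \<iota> t) \<ominus>\<^bsub>K\<^esub> (a \<ominus>\<^bsub>K\<^esub> \<iota> q) = \<iota> (q - t)"
    using assms(1) by (simp add: K.minus_minus_cancel \<iota>_diff)
  moreover have "absp (a \<ominus>\<^bsub>K\<^esub> \<iota> q) \<le> real p powi (- m)"
    using q powi_p_mono[of "- (m + 1)" "- m"] by linarith
  ultimately have "nrm (q - t) \<le> real p powi (- m)"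
    using absp_diff_le[OF _ _ assms(2), of "a \<ominus>\<^bsub>K\<^esub> \<iota> q"] assms(1) by (simp add: absp_\<iota>)
  then obtain c where c: "c < p" "nrm (q - t - of_nat c * of_nat p powi m) \<le> ?e"
    by (rule rat_digit)
  then have "absp (a \<ominus>\<^bsub>K\<^esub> \<iota> (t + of_nat c * of_nat p powi m)) \<le> ?e"
    by (intro absp_minus_\<iota>_le[OF assms(1) q]) (simp add: algebra_simps)
  with c show ?thesis using that by blast
qed

lemma expansion_exists:
  assumes "a \<in> carrier K" "a \<noteq> \<zero>\<^bsub>K\<^esub>"
  shows "\<exists>m c. Qp_expansion p a m c"
proof -
  obtain k where k: "absp a = real p powi k" by (rule absp_value[OF assms])
  \<comment> \<open>With this leading index the digit at \<open>m\<close> is nonzero.\<close>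
  define m where "m = - k"
  have m: "absp a = real p powi (- m)" using k by (simp add: m_def)
  have a0: "a \<ominus>\<^bsub>K\<^esub> \<iota> 0 = a" using assms by (simp add: \<iota>_0 a_minus_def)
  \<comment> \<open>The partial sums \<open>S j\<close> of the expansion; \<open>S j\<close> uses the digits at \<open>m, \<dots>, m + j - 1\<close>.\<close>
  have "\<exists>S. \<forall>j. (absp (a \<ominus>\<^bsub>K\<^esub> \<iota> (S j)) \<le> real p powi (- (m + int j)) \<and> (j = 0 \<longrightarrow> S j = 0)) \<and>
      (\<exists>c<p. S (Suc j) = S j + of_nat c * of_nat p powi (m + int j))"
  proof (rule dependent_nat_choice)
    show "\<exists>t. absp (a \<ominus>\<^bsub>K\<^esub> \<iota> t) \<le> real p powi (- (m + int 0)) \<and> ((0::nat) = 0 \<longrightarrow> t = 0)"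
      using m a0 by (intro exI[of _ 0]) simp
  next
    fix t j
    assume "absp (a \<ominus>\<^bsub>K\<^esub> \<iota> t) \<le> real p powi (- (m + int j)) \<and> (j = 0 \<longrightarrow> t = 0)"
    then obtain c where "c < p"
      "absp (a \<ominus>\<^bsub>K\<^esub> \<iota> (t + of_nat c * of_nat p powi (m + int j))) \<le> real p powi (- (m + int j + 1))"
      using next_digit[OF assms(1), of t "m + int j"] by blast
    then show "\<exists>t'. (absp (a \<ominus>\<^bsub>K\<^esub> \<iota> t') \<le> real p powi (- (m + int (Suc j))) \<and> (Suc j = 0 \<longrightarrow> t' = 0)) \<and>
        (\<exists>c<p. t' = t + of_nat c * of_nat p powi (m + int j))"
      by (intro exI[of _ "t + of_nat c * of_nat p powi (m + int j)"]) (auto simp: algebra_simps)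
  qed
  then obtain S where S: "\<And>j. absp (a \<ominus>\<^bsub>K\<^esub> \<iota> (S j)) \<le> real p powi (- (m + int j))" "S 0 = 0"
    and "\<forall>j. \<exists>c<p. S (Suc j) = S j + of_nat c * of_nat p powi (m + int j)"
    by blast
  then obtain d where d: "\<And>j. d j < p"
    "\<And>j. S (Suc j) = S j + of_nat (d j) * of_nat p powi (m + int j)" by metis
  define c where "c = (\<lambda>n. d (nat (n - m)))"
  have sum: "digit_sum p m c (m + int j - 1) = S j" for j
  proof (induction j)
    case (Suc j)
    have "{m..m + int (Suc j) - 1} = insert (m + int j) {m..m + int j - 1}" by auto
    then show ?case using Suc d(2)[of j] by (simp add: digit_sum_def c_def)
  qed (simp add: digit_sum_def S)
  have "d 0 \<noteq> 0"
  proof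
    assume "d 0 = 0"
    then have "S 1 = 0" using d(2)[of 0] S(2) by simp
    then have "absp a \<le> real p powi (- (m + 1))" using S(1)[of 1] a0 by simp
    moreover have "real p powi (- (m + 1)) < real p powi (- m)"
      using p_gt_1 by (intro power_int_strict_increasing) auto
    ultimately show False using m by simp
  qed
  then have "c m \<noteq> 0" by (simp add: c_def)
  moreover have "\<forall>n\<ge>m. c n \<in> {0..p - 1}"
  proof (intro allI impI)
    fix n
    show "c n \<in> {0..p - 1}" using d(1)[of "nat (n - m)"] by (simp add: c_def)
  qed
  moreover have "(\<lambda>N. absp (a \<ominus>\<^bsub>K\<^esub> \<iota> (digit_sum p m c (int N)))) \<longlonglongrightarrow> 0"
  proof (rule tendsto_sandwich)
    show "\<forall>\<^sub>F N in sequentially. 0 \<le> absp (a \<ominus>\<^bsub>K\<^esub> \<iota> (digit_sum p m c (int N)))"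
      using assms(1) by (intro always_eventually allI absp_nonneg) auto
    have "absp (a \<ominus>\<^bsub>K\<^esub> \<iota> (digit_sum p m c (int N))) \<le> (1 / real p) ^ N" if "N \<ge> nat m" for N
    proof -
      have "digit_sum p m c (int N) = S (nat (int N - m + 1))"
        using sum[of "nat (int N - m + 1)"] that by simp
      then have "absp (a \<ominus>\<^bsub>K\<^esub> \<iota> (digit_sum p m c (int N))) \<le> real p powi (- (int N + 1))"
        using S(1)[of "nat (int N - m + 1)"] that by simp
      also have "\<dots> \<le> real p powi (- int N)" by (rule powi_p_mono) simp
      also have "\<dots> = (1 / real p) ^ N" by (simp add: power_int_minus power_one_over inverse_eq_divide)
      finally show ?thesis .
    qed
    then show "\<forall>\<^sub>F N in sequentially. absp (a \<ominus>\<^bsub>K\<^esub> \<iota> (digit_sum p m c (int N))) \<le> (1 / real p) ^ N"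
      by (auto simp: eventually_sequentially)
    show "(\<lambda>N. (1 / real p) ^ N) \<longlonglongrightarrow> 0" using p_gt_1 by (intro LIMSEQ_power_zero) auto
  qed simp
  ultimately show ?thesis unfolding Qp_expansion_def by blast
qed

text \<open>A description of the floor without digits: the only element of \<open>\<int>[1/p]\<close> in the real interval
  \<open>[0, p)\<close> that is congruent to \<open>a\<close> modulo the maximal ideal of the \<open>p\<close>-adic integers.\<close>

definition is_floor :: "(nat \<Rightarrow> rat) set \<Rightarrow> rat \<Rightarrow> bool" where
  "is_floor a q \<longleftrightarrow> 0 \<le> q \<and> q < of_nat p \<and> (\<exists>e k. q = of_int e / of_nat p ^ k) \<and>
     absp (a \<ominus>\<^bsub>K\<^esub> \<iota> q) < 1"

text \<open>The difference of two candidates lies in \<open>\<int>[1/p]\<close> and has \<open>p\<close>-adic absolute value below \<open>1\<close>,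
  so it is an integer multiple of \<open>p\<close>; its real absolute value is below \<open>p\<close>, so it vanishes.\<close>

lemma is_floor_unique:
  assumes a: "a \<in> carrier K" and q: "is_floor a q" and q': "is_floor a q'"
  shows "q = q'"
proof -
  obtain e k where e: "q = of_int e / of_nat p ^ k" using q by (auto simp: is_floor_def)
  obtain e' k' where e': "q' = of_int e' / of_nat p ^ k'" using q' by (auto simp: is_floor_def)
  have p0: "(of_nat p :: rat) \<noteq> 0" using p_gt_1 by simp
  define f where "f = e * int p ^ k' - e' * int p ^ k"
  have f: "q - q' = of_int f / of_nat p ^ (k + k')"
    using p0 by (simp add: e e' f_def field_simps power_add)
  have "(a \<ominus>\<^bsub>K\<^esub> \<iota> q') \<ominus>\<^bsub>K\<^esub> (a \<ominus>\<^bsub>K\<^esub> \<iota> q) = \<iota> (q - q')"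
    using a by (simp add: K.minus_minus_cancel \<iota>_diff)
  then have "absp (\<iota> (q - q')) < 1"
    using q q' a absp_diff[of "a \<ominus>\<^bsub>K\<^esub> \<iota> q'" "a \<ominus>\<^bsub>K\<^esub> \<iota> q"]
    by (auto simp: is_floor_def max_def split: if_splits)
  then have "nrm (q - q') \<le> 1 / real p" using absp_less_1[of "\<iota> (q - q')"] by (simp add: absp_\<iota>)
  then have "nrm (of_int f) \<le> 1 / real p ^ Suc (k + k')"
    using p_gt_1 by (simp add: f nrm_divide nrm_power nrm_p field_simps)
  also have "\<dots> = real p powi (- int (Suc (k + k')))"
    by (simp only: power_int_minus power_int_of_nat inverse_eq_divide)
  finally have "nrm (of_int f) \<le> real p powi (- int (Suc (k + k')))" .
  then have "int p ^ Suc (k + k') dvd f" by (simp only: nrm_of_int_le_iff)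
  then obtain t where "f = int p ^ Suc (k + k') * t" by (elim dvdE)
  then have t: "q - q' = of_nat p * of_int t" using p0 by (simp add: f)
  have "\<bar>q - q'\<bar> < of_nat p" using q q' unfolding is_floor_def by linarith
  then have "of_nat p * \<bar>of_int t\<bar> < (of_nat p * 1 :: rat)" by (simp add: t abs_mult)
  then have "t = 0" using p_gt_1 by simp
  then show ?thesis using t by simp
qed

text \<open>The upper bound \<open>p - p powi (- k)\<close>, rather than \<open>p\<close>, makes the induction go through; it is
  attained when all digits are \<open>p - 1\<close>.\<close>

lemma digit_sum_nonpos_bounds:
  assumes "\<forall>n\<ge>- int k. c n \<in> {0..p - 1}"
  shows "digit_sum p (- int k) c 0 \<le> of_nat p - of_nat p powi (- int k) \<and> 0 \<le> digit_sum p (- int k) c 0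
    \<and> (\<exists>e. digit_sum p (- int k) c 0 = of_int e / of_nat p ^ k)"
  using assms
proof (induction k)
  case 0
  then have "c 0 \<le> p - 1" by simp
  then have "of_nat (c 0) \<le> (of_nat (p - 1) :: rat)" by (simp only: of_nat_le_iff)
  then have "of_nat (c 0) \<le> (of_nat p - 1 :: rat)" using p_gt_1 by simp
  moreover have "digit_sum p (- int 0) c 0 = of_nat (c 0)" by (simp add: digit_sum_def)
  moreover have "(of_nat (c 0) :: rat) = of_int (int (c 0)) / of_nat p ^ 0" by simp
  ultimately show ?case by (metis of_nat_0_le_iff of_nat_0 minus_zero power_int_0_right)
next
  case (Suc k)
  let ?n = "- int (Suc k)"
  have "{?n..0} = insert ?n {- int k..0}" by auto
  then have eq: "digit_sum p ?n c 0 = of_nat (c ?n) * of_nat p powi ?n + digit_sum p (- int k) c 0"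
    by (simp add: digit_sum_def)
  have IH: "digit_sum p (- int k) c 0 \<le> of_nat p - of_nat p powi (- int k)"
    "0 \<le> digit_sum p (- int k) c 0" "\<exists>e. digit_sum p (- int k) c 0 = of_int e / of_nat p ^ k"
    using Suc by auto
  have p0: "(of_nat p :: rat) > 0" using p_gt_1 by simp
  have pp: "(of_nat p :: rat) powi (- int k) = of_nat p * of_nat p powi ?n"
    using p0 power_int_add[of "of_nat p :: rat" 1 ?n] by simp
  have "c ?n \<le> p - 1" using Suc.prems by auto
  then have "of_nat (c ?n) \<le> (of_nat (p - 1) :: rat)" by (simp only: of_nat_le_iff)
  then have "of_nat (c ?n) \<le> (of_nat p - 1 :: rat)" using p_gt_1 by simp
  then have "of_nat (c ?n) * of_nat p powi ?n \<le> (of_nat p - 1) * (of_nat p powi ?n :: rat)"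
    using p0 by (intro mult_right_mono) auto
  then have "digit_sum p ?n c 0 \<le> of_nat p - of_nat p powi ?n"
    using eq IH(1) pp by (simp add: algebra_simps)
  moreover have "0 \<le> digit_sum p ?n c 0" using eq IH(2) p0 by simp
  ultimately have bd: "digit_sum p ?n c 0 \<le> of_nat p - of_nat p powi ?n \<and> 0 \<le> digit_sum p ?n c 0"
    by blast
  obtain e where e: "digit_sum p (- int k) c 0 = of_int e / of_nat p ^ k" using IH(3) by blast
  have pn: "(of_nat p :: rat) powi ?n = 1 / of_nat p ^ Suc k"
    by (simp only: power_int_minus power_int_of_nat inverse_eq_divide)
  have "digit_sum p ?n c 0 = of_int (int (c ?n) + e * int p) / of_nat p ^ Suc k"
  proof -
    have "digit_sum p ?n c 0 = of_nat (c ?n) * (1 / of_nat p ^ Suc k) + of_int e / of_nat p ^ k"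
      unfolding eq pn e ..
    also have "\<dots> = (of_nat (c ?n) + of_int e * of_nat p) / of_nat p ^ Suc k"
      using p0 by (simp add: add_divide_distrib)
    finally show ?thesis by simp
  qed
  then show ?case using bd by blast
qed

lemma nrm_sum_le:
  assumes "finite A" "\<And>x. x \<in> A \<Longrightarrow> nrm (f x) \<le> r" "r \<ge> 0"
  shows "nrm (sum f A) \<le> r"
  using assms by (induction A rule: finite_induct) (auto intro: nrm_add_le)

lemma is_floor_expansion:
  assumes a: "a \<in> carrier K" and ex: "Qp_expansion p a m c"
  shows "is_floor a (if m \<le> 0 then digit_sum p m c 0 else 0)"
proof -
  define q where "q = (if m \<le> 0 then digit_sum p m c 0 else 0)"
  have p0: "(of_nat p :: rat) > 0" using p_gt_1 by simp
  have c: "\<forall>n\<ge>m. c n \<in> {0..p - 1}" using ex by (simp add: Qp_expansion_def)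
  have frac: "0 \<le> q \<and> q < of_nat p \<and> (\<exists>e k. q = of_int e / of_nat p ^ k)"
  proof (cases "m \<le> 0")
    case True
    then have m: "m = - int (nat (- m))" by simp
    have "(of_nat p powi m :: rat) > 0" using p0 by simp
    then show ?thesis
      using digit_sum_nonpos_bounds[of "nat (- m)" c] c True unfolding m[symmetric] q_def by force
  next
    case False
    have "q = of_int 0 / of_nat p ^ 0" using False by (simp add: q_def)
    then show ?thesis using False p0 unfolding q_def by auto
  qed
  have le: "absp (a \<ominus>\<^bsub>K\<^esub> \<iota> q) \<le> 1 / real p"
  proof -
    have "\<forall>\<^sub>F N in sequentially. absp (a \<ominus>\<^bsub>K\<^esub> \<iota> (digit_sum p m c (int N))) < 1 / real p"
      using ex p_gt_1 unfolding Qp_expansion_def by (intro order_tendstoD(2)) auto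
    then obtain N where N: "absp (a \<ominus>\<^bsub>K\<^esub> \<iota> (digit_sum p m c (int N))) < 1 / real p"
      by (auto simp: eventually_sequentially)
    \<comment> \<open>The digits dropped by the floor all carry positive powers of p.\<close>
    have split: "{m..int N} = {m..0} \<union> {max m 1..int N}"
      and disj: "{m..0} \<inter> {max m 1..int N} = {}" by auto
    have "digit_sum p m c (int N) =
        digit_sum p m c 0 + (\<Sum>n\<in>{max m 1..int N}. of_nat (c n) * of_nat p powi n)"
      unfolding digit_sum_def split by (rule sum.union_disjoint) (use disj in auto)
    moreover have "q = digit_sum p m c 0" by (simp add: q_def digit_sum_def)
    ultimately have "digit_sum p m c (int N) =
        q + (\<Sum>n\<in>{max m 1..int N}. of_nat (c n) * of_nat p powi n)" by simp
    moreover have "nrm (\<Sum>n\<in>{max m 1..int N}. of_nat (c n) * of_nat p powi n) \<le> 1 / real p"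
    proof (rule nrm_sum_le)
      fix n assume n: "n \<in> {max m 1..int N}"
      have "nrm (of_nat (c n) * of_nat p powi n) \<le> 1 * real p powi (- n)"
        unfolding nrm_mult nrm_p_powi
        using nrm_of_int_le_1[of "int (c n)"] by (intro mult_right_mono) auto
      also have "\<dots> \<le> real p powi (- 1)" using n powi_p_mono[of "- n" "- 1"] by simp
      finally show "nrm (of_nat (c n) * of_nat p powi n) \<le> 1 / real p"
        by (simp add: power_int_minus inverse_eq_divide)
    qed auto
    ultimately show ?thesis
      using N by (intro absp_minus_\<iota>_le[OF a less_imp_le[OF N]]) simp
  qed
  have "absp (a \<ominus>\<^bsub>K\<^esub> \<iota> q) < 1" by (rule le_less_trans[OF le]) (use p_gt_1 in simp)
  with frac have "is_floor a q" by (simp add: is_floor_def)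
  then show ?thesis by (simp only: q_def)
qed

lemma is_floor_Qp_floor:
  assumes a: "a \<in> carrier K" shows "is_floor a (Qp_floor p a)"
proof (cases "a = \<zero>\<^bsub>K\<^esub>")
  case True
  have "a \<ominus>\<^bsub>K\<^esub> \<iota> 0 = \<zero>\<^bsub>K\<^esub>" by (simp add: True \<iota>_0 a_minus_def)
  then have "absp (a \<ominus>\<^bsub>K\<^esub> \<iota> 0) < 1" by simp
  moreover have "\<exists>e k. (0::rat) = of_int e / of_nat p ^ k" by (intro exI[of _ 0]) simp
  ultimately have "is_floor a 0" using p_gt_1 by (simp add: is_floor_def)
  moreover have "Qp_floor p a = 0" using True by (simp add: Qp_floor_def)
  ultimately show ?thesis by simp
next
  case False
  obtain m c where mc: "Qp_expansion p a m c" using expansion_exists[OF a False] by blast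
  let ?q = "if m \<le> 0 then digit_sum p m c 0 else 0"
  have "Qp_floor p a = ?q"
    unfolding Qp_floor_def if_not_P[OF False]
  proof (rule the_equality)
    show "\<exists>m c. Qp_expansion p a m c \<and> ?q = (if m \<le> 0 then digit_sum p m c 0 else 0)"
      using mc by blast
  next
    fix q assume "\<exists>m c. Qp_expansion p a m c \<and> q = (if m \<le> 0 then digit_sum p m c 0 else 0)"
    then have "is_floor a q" using is_floor_expansion[OF a] by blast
    then show "q = ?q" by (rule is_floor_unique[OF a _ is_floor_expansion[OF a mc]])
  qed
  then show ?thesis using is_floor_expansion[OF a mc] by simp
qed

section \<open>Infinite Ruban continued fractions\<close>

lemmas K_ring_simps = a_minus_def K.minus_add K.a_ac K.l_distr K.r_distr K.m_ac K.l_minus K.r_minus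
  K.r_neg K.r_neg1 K.r_neg2

text \<open>\<open>\<alpha>\<close> is an infinite sequence of complete quotients with partial quotients \<open>a\<close>. The relation
  \<open>\<alpha> (Suc n) = 1 / (\<alpha> n - a n)\<close> is stated without division, which also says that the process does
  not stop. Of the floor only \<open>\<bar>\<alpha> n - a n\<bar> < 1\<close> is recorded; this is enough for uniqueness.\<close>

definition ruban_expansion :: "(nat \<Rightarrow> (nat \<Rightarrow> rat) set) \<Rightarrow> (nat \<Rightarrow> rat) \<Rightarrow> bool" where
  "ruban_expansion \<alpha> a \<longleftrightarrow> (\<forall>n. \<alpha> n \<in> carrier K \<and> absp (\<alpha> n \<ominus>\<^bsub>K\<^esub> \<iota> (a n)) < 1 \<and>
     \<alpha> (Suc n) \<otimes>\<^bsub>K\<^esub> (\<alpha> n \<ominus>\<^bsub>K\<^esub> \<iota> (a n)) = \<one>\<^bsub>K\<^esub>)"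

text \<open>With \<open>u = \<alpha> n - a n\<close> and \<open>v = \<beta> n - a n\<close>, both of absolute value at most \<open>1 / p\<close>, one has
  \<open>u - v = u v (1 / v - 1 / u)\<close>.\<close>

lemma ruban_expansion_contraction:
  assumes "ruban_expansion \<alpha> a" "ruban_expansion \<beta> a"
  shows "absp (\<alpha> n \<ominus>\<^bsub>K\<^esub> \<beta> n) \<le> (1 / real p) * absp (\<alpha> (Suc n) \<ominus>\<^bsub>K\<^esub> \<beta> (Suc n))"
proof -
  define u where "u = \<alpha> n \<ominus>\<^bsub>K\<^esub> \<iota> (a n)"
  define v where "v = \<beta> n \<ominus>\<^bsub>K\<^esub> \<iota> (a n)"
  let ?A = "\<alpha> (Suc n)" and ?B = "\<beta> (Suc n)"
  have c: "\<alpha> n \<in> carrier K" "\<beta> n \<in> carrier K" "?A \<in> carrier K" "?B \<in> carrier K"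
    and u: "u \<in> carrier K" "absp u < 1" "?A \<otimes>\<^bsub>K\<^esub> u = \<one>\<^bsub>K\<^esub>"
    and v: "v \<in> carrier K" "absp v < 1" "?B \<otimes>\<^bsub>K\<^esub> v = \<one>\<^bsub>K\<^esub>"
    using assms by (auto simp: ruban_expansion_def u_def v_def)
  have "\<alpha> n \<ominus>\<^bsub>K\<^esub> \<beta> n = u \<ominus>\<^bsub>K\<^esub> v"
    using c by (simp add: u_def v_def K.minus_minus_cancel)
  also have "\<dots> = u \<otimes>\<^bsub>K\<^esub> (?B \<otimes>\<^bsub>K\<^esub> v) \<ominus>\<^bsub>K\<^esub> v \<otimes>\<^bsub>K\<^esub> (?A \<otimes>\<^bsub>K\<^esub> u)"
    using u v by simp
  also have "\<dots> = (u \<otimes>\<^bsub>K\<^esub> v) \<otimes>\<^bsub>K\<^esub> (?B \<ominus>\<^bsub>K\<^esub> ?A)"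
    using u(1) v(1) c by (simp add: K_ring_simps)
  finally have "absp (\<alpha> n \<ominus>\<^bsub>K\<^esub> \<beta> n) = (absp u * absp v) * absp (?B \<ominus>\<^bsub>K\<^esub> ?A)"
    using u v c by (simp add: absp_mult)
  also have "absp (?B \<ominus>\<^bsub>K\<^esub> ?A) = absp (?A \<ominus>\<^bsub>K\<^esub> ?B)"
  proof -
    have "?B \<ominus>\<^bsub>K\<^esub> ?A = \<zero>\<^bsub>K\<^esub> \<ominus>\<^bsub>K\<^esub> (?A \<ominus>\<^bsub>K\<^esub> ?B)" "?A \<ominus>\<^bsub>K\<^esub> ?B = \<zero>\<^bsub>K\<^esub> \<ominus>\<^bsub>K\<^esub> (?B \<ominus>\<^bsub>K\<^esub> ?A)"
      using c by (simp_all add: K_ring_simps)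
    then show ?thesis
      using c absp_diff[of "\<zero>\<^bsub>K\<^esub>" "?A \<ominus>\<^bsub>K\<^esub> ?B"] absp_diff[of "\<zero>\<^bsub>K\<^esub>" "?B \<ominus>\<^bsub>K\<^esub> ?A"]
        absp_nonneg[of "?A \<ominus>\<^bsub>K\<^esub> ?B"] absp_nonneg[of "?B \<ominus>\<^bsub>K\<^esub> ?A"] by (simp add: max_def split: if_splits)
  qed
  also have "(absp u * absp v) * absp (?A \<ominus>\<^bsub>K\<^esub> ?B) \<le> (1 / real p * 1) * absp (?A \<ominus>\<^bsub>K\<^esub> ?B)"
    using absp_less_1[OF u(1,2)] v u c
    by (intro mult_right_mono mult_mono absp_nonneg) auto
  finally show ?thesis by simp
qed

text \<open>The partial quotients determine the number that is expanded.\<close>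

lemma ruban_expansion_unique:
  assumes "ruban_expansion \<alpha> a" "ruban_expansion \<beta> a"
  shows "\<alpha> 0 = \<beta> 0"
proof -
  define d where "d n = absp (\<alpha> n \<ominus>\<^bsub>K\<^esub> \<beta> n)" for n
  have c: "\<alpha> n \<in> carrier K" "\<beta> n \<in> carrier K" for n
    using assms by (auto simp: ruban_expansion_def)
  have bounded: "d n \<le> 1" for n
  proof -
    have "\<alpha> n \<ominus>\<^bsub>K\<^esub> \<beta> n = (\<alpha> n \<ominus>\<^bsub>K\<^esub> \<iota> (a n)) \<ominus>\<^bsub>K\<^esub> (\<beta> n \<ominus>\<^bsub>K\<^esub> \<iota> (a n))"
      using c by (simp add: K.minus_minus_cancel)
    moreover have "absp (\<alpha> n \<ominus>\<^bsub>K\<^esub> \<iota> (a n)) \<le> 1" "absp (\<beta> n \<ominus>\<^bsub>K\<^esub> \<iota> (a n)) \<le> 1"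
      using assms by (auto simp: ruban_expansion_def less_imp_le)
    ultimately show ?thesis using c by (simp add: d_def absp_diff_le)
  qed
  have "d 0 \<le> (1 / real p) ^ n * d n" for n
  proof (induction n)
    case (Suc n)
    note Suc
    also have "(1 / real p) ^ n * d n \<le> (1 / real p) ^ n * ((1 / real p) * d (Suc n))"
      using ruban_expansion_contraction[OF assms, of n] unfolding d_def
      by (intro mult_left_mono) auto
    finally show ?case by (simp add: mult_ac)
  qed simp
  moreover have "(1 / real p) ^ n * d n \<le> (1 / real p) ^ n * 1" for n
    using bounded by (intro mult_left_mono) auto
  ultimately have le: "d 0 \<le> (1 / real p) ^ n" for n
    by (metis order_trans mult.right_neutral)
  have "(\<lambda>n. (1 / real p) ^ n) \<longlonglongrightarrow> 0" using p_gt_1 by (intro LIMSEQ_power_zero) auto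
  then have "d 0 \<le> 0" by (rule LIMSEQ_le_const) (use le in auto)
  then have "d 0 = 0" using absp_nonneg[of "\<alpha> 0 \<ominus>\<^bsub>K\<^esub> \<beta> 0"] c by (simp add: d_def)
  then show ?thesis using c by (simp add: d_def absp_eq_0_iff)
qed

text \<open>If \<open>\<alpha> = (z \<beta> + w) / (x \<beta> + y)\<close> and \<open>\<beta> = t + 1 / \<gamma>\<close>, then \<open>\<alpha>\<close> is the corresponding
  linear fractional expression in \<open>\<gamma>\<close>. Fractions are cleared.\<close>

lemma moebius_step:
  assumes "\<alpha> \<in> carrier K" "\<beta> \<in> carrier K" "\<gamma> \<in> carrier K"
    and "\<gamma> \<otimes>\<^bsub>K\<^esub> (\<beta> \<ominus>\<^bsub>K\<^esub> \<iota> t) = \<one>\<^bsub>K\<^esub>"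
    and "\<alpha> \<otimes>\<^bsub>K\<^esub> (\<iota> x \<otimes>\<^bsub>K\<^esub> \<beta> \<oplus>\<^bsub>K\<^esub> \<iota> y) = \<iota> z \<otimes>\<^bsub>K\<^esub> \<beta> \<oplus>\<^bsub>K\<^esub> \<iota> w"
  shows "\<alpha> \<otimes>\<^bsub>K\<^esub> (\<iota> (x * t + y) \<otimes>\<^bsub>K\<^esub> \<gamma> \<oplus>\<^bsub>K\<^esub> \<iota> x) = \<iota> (z * t + w) \<otimes>\<^bsub>K\<^esub> \<gamma> \<oplus>\<^bsub>K\<^esub> \<iota> z"
proof -
  note i = \<iota>_closed[of x] \<iota>_closed[of y] \<iota>_closed[of z] \<iota>_closed[of w] \<iota>_closed[of t]
  have one: "\<gamma> \<otimes>\<^bsub>K\<^esub> \<beta> = \<iota> t \<otimes>\<^bsub>K\<^esub> \<gamma> \<oplus>\<^bsub>K\<^esub> \<one>\<^bsub>K\<^esub>"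
  proof -
    have "\<gamma> \<otimes>\<^bsub>K\<^esub> \<beta> = \<iota> t \<otimes>\<^bsub>K\<^esub> \<gamma> \<oplus>\<^bsub>K\<^esub> \<gamma> \<otimes>\<^bsub>K\<^esub> (\<beta> \<ominus>\<^bsub>K\<^esub> \<iota> t)"
      using assms(1-3) i by (simp add: K_ring_simps)
    then show ?thesis using assms(4) by simp
  qed
  have *: "\<gamma> \<otimes>\<^bsub>K\<^esub> (\<iota> x' \<otimes>\<^bsub>K\<^esub> \<beta> \<oplus>\<^bsub>K\<^esub> \<iota> y') = \<iota> (x' * t + y') \<otimes>\<^bsub>K\<^esub> \<gamma> \<oplus>\<^bsub>K\<^esub> \<iota> x'" for x' y'
  proof -
    note i' = \<iota>_closed[of x'] \<iota>_closed[of y'] \<iota>_closed[of t]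
    have "\<gamma> \<otimes>\<^bsub>K\<^esub> (\<iota> x' \<otimes>\<^bsub>K\<^esub> \<beta> \<oplus>\<^bsub>K\<^esub> \<iota> y') = \<iota> x' \<otimes>\<^bsub>K\<^esub> (\<gamma> \<otimes>\<^bsub>K\<^esub> \<beta>) \<oplus>\<^bsub>K\<^esub> \<iota> y' \<otimes>\<^bsub>K\<^esub> \<gamma>"
      using assms(1-3) i' by (simp add: K_ring_simps)
    also have "\<dots> = (\<iota> x' \<otimes>\<^bsub>K\<^esub> \<iota> t \<oplus>\<^bsub>K\<^esub> \<iota> y') \<otimes>\<^bsub>K\<^esub> \<gamma> \<oplus>\<^bsub>K\<^esub> \<iota> x'"
      unfolding one using assms(1-3) i' by (simp add: K_ring_simps)
    finally show ?thesis by (simp add: \<iota>_add \<iota>_mult)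
  qed
  have "\<alpha> \<otimes>\<^bsub>K\<^esub> (\<gamma> \<otimes>\<^bsub>K\<^esub> (\<iota> x \<otimes>\<^bsub>K\<^esub> \<beta> \<oplus>\<^bsub>K\<^esub> \<iota> y)) = \<gamma> \<otimes>\<^bsub>K\<^esub> (\<alpha> \<otimes>\<^bsub>K\<^esub> (\<iota> x \<otimes>\<^bsub>K\<^esub> \<beta> \<oplus>\<^bsub>K\<^esub> \<iota> y))"
    using assms(1-3) i by (simp add: K_ring_simps)
  then show ?thesis unfolding assms(5) * .
qed

text \<open>The coefficients are those of the product of the matrices with rows \<open>(a i, 1)\<close> and \<open>(1, 0)\<close>.
  The clause \<open>C + E > 0\<close> is what makes \<open>C\<close> positive after the next step.\<close>

lemma ruban_moebius:
  assumes ex: "ruban_expansion \<alpha> a" and pos: "\<And>n. a n > 0"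
  shows "\<exists>A B C E. A \<ge> 0 \<and> B \<ge> 0 \<and> C \<ge> 0 \<and> E \<ge> 0 \<and> C + E > 0 \<and> (l > 0 \<longrightarrow> C > 0) \<and>
    \<alpha> 0 \<otimes>\<^bsub>K\<^esub> (\<iota> C \<otimes>\<^bsub>K\<^esub> \<alpha> l \<oplus>\<^bsub>K\<^esub> \<iota> E) = \<iota> A \<otimes>\<^bsub>K\<^esub> \<alpha> l \<oplus>\<^bsub>K\<^esub> \<iota> B"
proof (induction l)
  case 0
  have "\<alpha> 0 \<in> carrier K" using ex by (simp add: ruban_expansion_def)
  then have "\<alpha> 0 \<otimes>\<^bsub>K\<^esub> (\<iota> 0 \<otimes>\<^bsub>K\<^esub> \<alpha> 0 \<oplus>\<^bsub>K\<^esub> \<iota> 1) = \<iota> 1 \<otimes>\<^bsub>K\<^esub> \<alpha> 0 \<oplus>\<^bsub>K\<^esub> \<iota> 0"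
    by (simp add: \<iota>_0 \<iota>_1)
  then show ?case
    by - (rule exI[of _ 1], rule exI[of _ 0], rule exI[of _ 0], rule exI[of _ 1], simp)
next
  case (Suc l)
  then obtain A B C E where h: "A \<ge> 0" "B \<ge> 0" "C \<ge> 0" "E \<ge> 0" "C + E > 0"
    and eq: "\<alpha> 0 \<otimes>\<^bsub>K\<^esub> (\<iota> C \<otimes>\<^bsub>K\<^esub> \<alpha> l \<oplus>\<^bsub>K\<^esub> \<iota> E) = \<iota> A \<otimes>\<^bsub>K\<^esub> \<alpha> l \<oplus>\<^bsub>K\<^esub> \<iota> B"
    by blast
  have t: "a l > 0" by (rule pos)
  have "C * a l + E > 0"
  proof (cases "C = 0")
    case False
    then have "C * a l > 0" using h t by simp
    then show ?thesis using h by linarith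
  qed (use h in simp)
  moreover have "A * a l + B \<ge> 0" using h t by simp
  moreover have "\<alpha> 0 \<otimes>\<^bsub>K\<^esub> (\<iota> (C * a l + E) \<otimes>\<^bsub>K\<^esub> \<alpha> (Suc l) \<oplus>\<^bsub>K\<^esub> \<iota> C)
      = \<iota> (A * a l + B) \<otimes>\<^bsub>K\<^esub> \<alpha> (Suc l) \<oplus>\<^bsub>K\<^esub> \<iota> A"
    using ex by (intro moebius_step[OF _ _ _ _ eq]) (simp_all add: ruban_expansion_def)
  ultimately show ?case using h
    by - (rule exI[of _ "A * a l + B"], rule exI[of _ A], rule exI[of _ "C * a l + E"],
        rule exI[of _ C], simp)
qed

lemma ruban_expansion_shift: "ruban_expansion \<alpha> a \<Longrightarrow> ruban_expansion (\<lambda>n. \<alpha> (n + k)) (\<lambda>n. a (n + k))"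
  by (simp add: ruban_expansion_def)

end

section \<open>Square roots of negative rationals\<close>

text \<open>A \<open>p\<close>-adic square root \<open>s\<close> of a negative rational. Negativity makes the norm form
  \<open>x\<^sup>2 - D * y\<^sup>2\<close> positive definite; irrationality of \<open>s\<close> follows from this.\<close>

locale imaginary_root = padic_prime +
  fixes s :: "(nat \<Rightarrow> rat) set" and D :: rat
  assumes s_closed: "s \<in> carrier (Qp p)"
    and s_square: "s \<otimes>\<^bsub>Qp p\<^esub> s = Qp_of_rat p D"
    and D_neg: "D < 0"
begin

text \<open>The elements \<open>x + y s\<close> of the subfield generated by \<open>s\<close> over the rationals, given by their
  rational coordinates.\<close>

definition lin :: "rat \<Rightarrow> rat \<Rightarrow> (nat \<Rightarrow> rat) set" where
  "lin x y = \<iota> x \<oplus>\<^bsub>K\<^esub> \<iota> y \<otimes>\<^bsub>K\<^esub> s"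

lemma lin_closed [simp, intro]: "lin x y \<in> carrier K"
  using s_closed by (simp add: lin_def)

lemma \<iota>_eq_lin: "\<iota> x = lin x 0"
  using s_closed by (simp add: lin_def \<iota>_0)

lemma lin_add: "lin x y \<oplus>\<^bsub>K\<^esub> lin x' y' = lin (x + x') (y + y')"
proof -
  note i = \<iota>_closed[of x] \<iota>_closed[of y] \<iota>_closed[of x'] \<iota>_closed[of y']
  show ?thesis unfolding lin_def \<iota>_add using s_closed i by (simp add: K_ring_simps)
qed

lemma lin_diff: "lin x y \<ominus>\<^bsub>K\<^esub> lin x' y' = lin (x - x') (y - y')"
proof -
  note i = \<iota>_closed[of x] \<iota>_closed[of y] \<iota>_closed[of x'] \<iota>_closed[of y']
  show ?thesis unfolding lin_def \<iota>_diff using s_closed i by (simp add: K_ring_simps)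
qed

lemma lin_mult: "lin x y \<otimes>\<^bsub>K\<^esub> lin x' y' = lin (x * x' + D * (y * y')) (x * y' + y * x')"
proof -
  note i = \<iota>_closed[of x] \<iota>_closed[of y] \<iota>_closed[of x'] \<iota>_closed[of y'] \<iota>_closed[of D]
  have "lin x y \<otimes>\<^bsub>K\<^esub> lin x' y' = \<iota> x \<otimes>\<^bsub>K\<^esub> \<iota> x' \<oplus>\<^bsub>K\<^esub> (s \<otimes>\<^bsub>K\<^esub> s) \<otimes>\<^bsub>K\<^esub> (\<iota> y \<otimes>\<^bsub>K\<^esub> \<iota> y')
     \<oplus>\<^bsub>K\<^esub> (\<iota> x \<otimes>\<^bsub>K\<^esub> \<iota> y' \<oplus>\<^bsub>K\<^esub> \<iota> y \<otimes>\<^bsub>K\<^esub> \<iota> x') \<otimes>\<^bsub>K\<^esub> s"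
    unfolding lin_def using s_closed i by (simp add: K_ring_simps)
  then show ?thesis by (simp add: s_square lin_def \<iota>_add \<iota>_mult)
qed

lemma norm_pos:
  assumes "y \<noteq> 0" shows "x\<^sup>2 - D * y\<^sup>2 > 0"
proof -
  have "D * y\<^sup>2 < 0" using assms D_neg by (simp add: mult_neg_pos)
  moreover have "x\<^sup>2 \<ge> 0" by simp
  ultimately show ?thesis by linarith
qed

text \<open>Coordinates are unique: multiplying \<open>u + v s = 0\<close> by its conjugate \<open>u - v s\<close> gives
  \<open>u\<^sup>2 - D * v\<^sup>2 = 0\<close>.\<close>

lemma lin_eq_iff: "lin x y = lin x' y' \<longleftrightarrow> x = x' \<and> y = y'"
proof
  assume eq: "lin x y = lin x' y'"
  define u v where uv: "u = x - x'" "v = y - y'"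
  have "lin u v = \<zero>\<^bsub>K\<^esub>" using eq by (simp add: uv flip: lin_diff)
  then have "lin u v \<otimes>\<^bsub>K\<^esub> lin u (- v) = \<iota> 0" by (simp add: \<iota>_0)
  then have "\<iota> (u\<^sup>2 - D * v\<^sup>2) = \<iota> 0"
    by (simp add: lin_mult \<iota>_eq_lin power2_eq_square algebra_simps)
  then have 0: "u\<^sup>2 - D * v\<^sup>2 = 0" by (simp only: \<iota>_eq_iff)
  then have "v = 0" using norm_pos[of v u] by fastforce
  with 0 show "x = x' \<and> y = y'" by (simp add: uv)
qed simp

text \<open>No complete quotient of \<open>s\<close> is rational, and each is a rational combination of \<open>1\<close> and \<open>s\<close>.\<close>

lemma ruban_expansion_lin:
  assumes ex: "ruban_expansion \<alpha> a" and "\<alpha> 0 = s"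
  shows "\<exists>x y. y \<noteq> 0 \<and> \<alpha> n = lin x y"
proof (induction n)
  case 0
  have "s = lin 0 1" using s_closed by (simp add: lin_def \<iota>_0 \<iota>_1)
  then show ?case using assms(2) by - (rule exI[of _ 0], rule exI[of _ 1], simp)
next
  case (Suc n)
  then obtain x y where xy: "y \<noteq> 0" "\<alpha> n = lin x y" by blast
  define z where "z = x - a n"
  define N where "N = z\<^sup>2 - D * y\<^sup>2"
  have N: "N > 0" unfolding N_def using xy(1) by (rule norm_pos)
  let ?w = "lin (z / N) (- y / N)"
  have c: "\<alpha> (Suc n) \<in> carrier K" using ex by (simp add: ruban_expansion_def)
  have eq: "\<alpha> n \<ominus>\<^bsub>K\<^esub> \<iota> (a n) = lin z y" by (simp add: xy(2) \<iota>_eq_lin lin_diff z_def)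
  have "\<alpha> (Suc n) \<otimes>\<^bsub>K\<^esub> (\<alpha> n \<ominus>\<^bsub>K\<^esub> \<iota> (a n)) = \<one>\<^bsub>K\<^esub>"
    using ex by (simp add: ruban_expansion_def)
  then have "\<alpha> (Suc n) \<otimes>\<^bsub>K\<^esub> lin z y = \<one>\<^bsub>K\<^esub>" by (simp only: eq)
  moreover have "lin z y \<otimes>\<^bsub>K\<^esub> ?w = \<one>\<^bsub>K\<^esub>"
  proof -
    have "z * (z / N) + D * (y * (- y / N)) = (z\<^sup>2 - D * y\<^sup>2) / N"
      by (simp add: power2_eq_square diff_divide_distrib)
    also have "\<dots> = 1" using N by (simp add: N_def)
    finally show ?thesis by (simp add: lin_mult \<iota>_eq_lin flip: \<iota>_1)
  qed
  ultimately have "\<alpha> (Suc n) = ?w"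
    using c K.m_assoc[of "\<alpha> (Suc n)" "lin z y" ?w] by simp
  then show ?case using xy(1) N by - (rule exI[of _ "z / N"], rule exI[of _ "- y / N"], simp)
qed

text \<open>A fixed point \<open>\<beta> = x + y s\<close> of \<open>\<beta> \<mapsto> (A \<beta> + B) / (C \<beta> + E)\<close> is a root of
  \<open>C X\<^sup>2 + (E - A) X - B\<close>, as is its conjugate when \<open>y \<noteq> 0\<close>. The product of the two roots is the
  norm \<open>x\<^sup>2 - D y\<^sup>2 > 0\<close> but also \<open>- B / C \<le> 0\<close>.\<close>

lemma no_positive_fixed_point:
  assumes "y \<noteq> 0" "C > 0" "B \<ge> 0"
  shows "lin x y \<otimes>\<^bsub>K\<^esub> (\<iota> C \<otimes>\<^bsub>K\<^esub> lin x y \<oplus>\<^bsub>K\<^esub> \<iota> E) \<noteq> \<iota> A \<otimes>\<^bsub>K\<^esub> lin x y \<oplus>\<^bsub>K\<^esub> \<iota> B"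
proof
  assume "lin x y \<otimes>\<^bsub>K\<^esub> (\<iota> C \<otimes>\<^bsub>K\<^esub> lin x y \<oplus>\<^bsub>K\<^esub> \<iota> E) = \<iota> A \<otimes>\<^bsub>K\<^esub> lin x y \<oplus>\<^bsub>K\<^esub> \<iota> B"
  then have eqs: "x * (C * x + E) + D * (y * (C * y)) = A * x + B"
    "x * (C * y) + y * (C * x + E) = A * y"
    by (simp_all add: \<iota>_eq_lin lin_mult lin_add lin_eq_iff)
  from eqs(2) have "y * (2 * C * x + E) = y * A" by (simp add: algebra_simps)
  then have A: "A = 2 * C * x + E" using assms(1) by simp
  have "B = - (C * (x\<^sup>2 - D * y\<^sup>2))"
    using eqs(1) unfolding A by (simp add: power2_eq_square algebra_simps)
  moreover have "C * (x\<^sup>2 - D * y\<^sup>2) > 0" using assms norm_pos by simp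
  ultimately show False using assms(3) by linarith
qed

lemma not_ultimately_periodic: "\<not> ruban_ultimately_periodic p s"
proof
  assume "ruban_ultimately_periodic p s"
  then obtain k l where inf: "\<And>n. ruban_partial_quotient p s n \<noteq> None" and l: "l \<ge> 1"
    and per: "\<And>n. n \<ge> k \<Longrightarrow> ruban_partial_quotient p s (n + l) = ruban_partial_quotient p s n"
    unfolding ruban_ultimately_periodic_def by blast
  define \<alpha> where "\<alpha> n = the (ruban_complete_quotient p s n)" for n
  define a where "a n = Qp_floor p (\<alpha> n)" for n
  have \<alpha>: "ruban_complete_quotient p s n = Some (\<alpha> n)" for n
    using inf[of n] by (auto simp: \<alpha>_def ruban_partial_quotient_def)
  have a: "ruban_partial_quotient p s n = Some (a n)" for n
    by (simp add: ruban_partial_quotient_def a_def \<alpha>)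
  have step: "\<alpha> n \<noteq> \<iota> (a n) \<and> \<alpha> (Suc n) = inv\<^bsub>K\<^esub> (\<alpha> n \<ominus>\<^bsub>K\<^esub> \<iota> (a n))" for n
    using \<alpha>[of "Suc n"] \<alpha>[of n] by (auto simp: a_def split: if_splits)
  have unit: "\<alpha> n \<ominus>\<^bsub>K\<^esub> \<iota> (a n) \<in> Units K" if "\<alpha> n \<in> carrier K" for n
    using step[of n] that by (simp add: K.field_Units)
  have closed: "\<alpha> n \<in> carrier K" for n
  proof (induction n)
    case 0
    then show ?case using \<alpha>[of 0] s_closed by simp
  next
    case (Suc n)
    then show ?case using step[of n] unit[of n] by simp
  qed
  have fl: "is_floor (\<alpha> n) (a n)" for n unfolding a_def by (rule is_floor_Qp_floor[OF closed])
  have ex: "ruban_expansion \<alpha> a"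
    using step unit closed fl by (auto simp: ruban_expansion_def is_floor_def)
  have pos: "a (Suc n) > 0" for n
  proof -
    have "a (Suc n) \<noteq> 0"
    proof
      \<comment> \<open>A complete quotient after the first is the inverse of a number of absolute value below
          \<open>1\<close>, so its floor is not \<open>0\<close>.\<close>
      assume "a (Suc n) = 0"
      then have "absp (\<alpha> (Suc n)) < 1"
        using fl[of "Suc n"] closed by (simp add: is_floor_def \<iota>_0 a_minus_def)
      moreover have "absp (\<alpha> n \<ominus>\<^bsub>K\<^esub> \<iota> (a n)) < 1" using fl[of n] by (simp add: is_floor_def)
      ultimately have "absp (\<alpha> (Suc n)) * absp (\<alpha> n \<ominus>\<^bsub>K\<^esub> \<iota> (a n)) < 1 * 1"
        using closed by (intro mult_strict_mono absp_nonneg) auto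
      moreover have "absp (\<alpha> (Suc n) \<otimes>\<^bsub>K\<^esub> (\<alpha> n \<ominus>\<^bsub>K\<^esub> \<iota> (a n))) = 1"
        using ex absp_\<iota>[of 1] by (simp add: ruban_expansion_def \<iota>_1)
      ultimately show False using closed by (simp add: absp_mult)
    qed
    then show ?thesis using fl[of "Suc n"] by (simp add: is_floor_def)
  qed
  \<comment> \<open>The shift is by \<open>Suc k\<close>, not \<open>k\<close>, because the partial quotient at \<open>0\<close> may vanish.\<close>
  define \<beta> where "\<beta> n = \<alpha> (n + Suc k)" for n
  define b where "b n = a (n + Suc k)" for n
  have exb: "ruban_expansion \<beta> b"
    unfolding \<beta>_def[abs_def] b_def[abs_def] by (rule ruban_expansion_shift[OF ex])
  have "b (n + l) = b n" for n
    using per[of "n + Suc k"] a[of "n + Suc k"] a[of "n + Suc k + l"] by (simp add: b_def add_ac)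
  then have "ruban_expansion (\<lambda>n. \<beta> (n + l)) b"
    using ruban_expansion_shift[OF exb, of l] by simp
  from ruban_expansion_unique[OF exb this] have per': "\<beta> l = \<beta> 0" by simp
  have "b n > 0" for n by (simp add: b_def pos)
  then obtain A B C E where BC: "B \<ge> 0" "C > 0"
    and "\<beta> 0 \<otimes>\<^bsub>K\<^esub> (\<iota> C \<otimes>\<^bsub>K\<^esub> \<beta> l \<oplus>\<^bsub>K\<^esub> \<iota> E) = \<iota> A \<otimes>\<^bsub>K\<^esub> \<beta> l \<oplus>\<^bsub>K\<^esub> \<iota> B"
    using ruban_moebius[OF exb, of l] l by auto
  then have fixed: "\<beta> 0 \<otimes>\<^bsub>K\<^esub> (\<iota> C \<otimes>\<^bsub>K\<^esub> \<beta> 0 \<oplus>\<^bsub>K\<^esub> \<iota> E) = \<iota> A \<otimes>\<^bsub>K\<^esub> \<beta> 0 \<oplus>\<^bsub>K\<^esub> \<iota> B"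
    by (simp only: per')
  have "\<alpha> 0 = s" using \<alpha>[of 0] by simp
  then obtain x y where xy: "y \<noteq> 0" "\<beta> 0 = lin x y"
    using ruban_expansion_lin[OF ex, of "Suc k"] by (auto simp: \<beta>_def)
  show False
    using fixed no_positive_fixed_point[OF xy(1) BC(2,1), of x E A] unfolding xy(2) by contradiction
qed

end

theorem corollary2p3:
  fixes p :: nat and D :: int and s :: "(nat \<Rightarrow> rat) set"
  assumes "prime p"
    and "\<not> is_square D"
    and "p \<noteq> 2 \<Longrightarrow> QuadRes (int p) D \<and> \<not> int p dvd D"
    and "p = 2 \<Longrightarrow> [D = 1] (mod 8)"
    and "s \<in> carrier (Qp p)"
    and "s [^]\<^bsub>Qp p\<^esub> (2::nat) = Qp_of_rat p (of_int D)"
    and "D < 0"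
  shows "\<not> ruban_ultimately_periodic p s"
proof -
  interpret padic_prime p by standard fact
  have "s \<otimes>\<^bsub>Qp p\<^esub> s = Qp_of_rat p (of_int D)"
    using assms(5,6) by (simp add: numeral_2_eq_2)
  then interpret imaginary_root p s "of_int D"
    using assms by unfold_locales auto
  show ?thesis by (rule not_ultimately_periodic)
qed

end
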